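(* Let $d \ge 2$ be an integer, let $0<\beta<1$ and $\lambda>0$, and consider the anti-ferromagnetic Ising model with edge activity $\beta$ and vertex activity $\lambda$ on the infinite rooted $d$-ary tree. If weak spatial mixing holds for this system, then strong spatial mixing holds for this system.
   Context: The infinite $d$-ary tree is the infinite rooted tree with root $\rho$ in which every vertex has exactly $d$ children. Ising model with edge activity $\beta$ and vertex activity $\lambda$: on a finite graph $(V,E)$ a configuration $\sigma:V\to\{+,-\}$ has weight $w(\sigma)=\lambda^{m(\sigma)}\beta^{n_+(\sigma)+n_-(\sigma)}$, where $m(\sigma)$ is the number of vertices with spin $-$ and $n_+(\sigma)$ (resp. $n_-(\sigma)$) is the number of edges with both endpoints $+$ (resp. both $-$); the Gibbs distribution is proportional to $w$. It is anti-ferromagnetic if $\beta<1$. On an infinite graph, a Gibbs measure is a probability measure on configurations such that for every finite vertex set $\Lambda$, conditionally on the configuration outside $\Lambda$, the probability of a configuration on $\Lambda$ is proportional to $\lambda^{m}\beta^{n}$, where $m$ is the number of vertices of $\Lambda$ with spin $-$ and $n$ is the number of edges with at least one endpoint in $\Lambda$ whose two endpoints have equal spins. If the spins on a vertex set $S$ are fixed to a configuration $\sigma$ on $S$, Gibbs measures for the conditioned system are defined in the same way, using only finite sets $\Lambda$ disjoint from $S$ and requiring the spins on $S$ to equal $\sigma$. For a nonempty set $S$ of vertices of the $d$-ary tree and a configuration $\sigma$ on $S$, $p_\rho(\sigma,S)$ denotes the probability that the root $\rho$ has spin $+$ when the spins on $S$ are fixed according to $\sigma$ (if the conditioned system has several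 Gibbs measures, the inequalities below are required for every choice of them). $\delta(\rho,S)$ is the graph distance from $\rho$ to $S$. Weak spatial mixing: there are constants $C,\kappa>0$ such that for every nonempty vertex set $S$ and any two configurations $\sigma_1,\sigma_2$ on $S$, $|p_\rho(\sigma_1,S)-p_\rho(\sigma_2,S)|\le C e^{-\kappa\,\delta(\rho,S)}$. Strong spatial mixing: there are constants $C,\kappa>0$ such that for every nonempty vertex set $S$, every nonempty $T\subseteq S$, and any two configurations $\sigma_1,\sigma_2$ on $S$ which differ only on vertices of $T$, $|p_\rho(\sigma_1,S)-p_\rho(\sigma_2,S)|\le C e^{-\kappa\,\delta(\rho,T)}$. *)

theory Defs
  imports "HOL-Probability.Probability"
begin

section \<open>Graph distance\<close>

text \<open>A simple graph is given by a vertex set \<open>V\<close> and a set \<open>E\<close> of two-element edges.\<close>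

definition adj :: "'v set set \<Rightarrow> 'v rel" where
  "adj E = {(u, v). {u, v} \<in> E}"

text \<open>Only meaningful for \<open>u\<close>, \<open>v\<close> in the same connected component.\<close>

definition graph_dist :: "'v set set \<Rightarrow> 'v \<Rightarrow> 'v \<Rightarrow> nat" where
  "graph_dist E u v = (LEAST n. (u, v) \<in> adj E ^^ n)"

definition set_graph_dist :: "'v set set \<Rightarrow> 'v \<Rightarrow> 'v set \<Rightarrow> nat" where
  "set_graph_dist E u S = (INF v\<in>S. graph_dist E u v)"


section \<open>The Ising model and its Gibbs measures\<close>

datatype spin = Plus | Minus

instance spin :: finite
proof
  have "(UNIV :: spin set) \<subseteq> {Plus, Minus}"
    using spin.exhaust by auto
  then show "finite (UNIV :: spin set)"
    by (rule finite_subset) simp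
qed

definition configs :: "'v set \<Rightarrow> ('v \<Rightarrow> spin) set" where
  "configs S = S \<rightarrow>\<^sub>E UNIV"

definition config_space :: "'v set \<Rightarrow> ('v \<Rightarrow> spin) measure" where
  "config_space V = (\<Pi>\<^sub>M v\<in>V. count_space UNIV)"

definition num_minus :: "'v set \<Rightarrow> ('v \<Rightarrow> spin) \<Rightarrow> nat" where
  "num_minus \<Lambda> \<omega> = card {v \<in> \<Lambda>. \<omega> v = Minus}"

definition num_equal_edges :: "'v set set \<Rightarrow> 'v set \<Rightarrow> ('v \<Rightarrow> spin) \<Rightarrow> nat" where
  "num_equal_edges E \<Lambda> \<omega> =
     card {e \<in> E. e \<inter> \<Lambda> \<noteq> {} \<and> (\<forall>u\<in>e. \<forall>v\<in>e. \<omega> u = \<omega> v)}"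

definition ising_weight ::
    "'v set set \<Rightarrow> real \<Rightarrow> real \<Rightarrow> 'v set \<Rightarrow> ('v \<Rightarrow> spin) \<Rightarrow> real" where
  "ising_weight E \<beta> lam \<Lambda> \<omega> =
     lam ^ num_minus \<Lambda> \<omega> * \<beta> ^ num_equal_edges E \<Lambda> \<omega>"

text \<open>The probability of \<open>\<tau>\<close> on the finite set \<open>\<Lambda>\<close> when the spins outside \<open>\<Lambda>\<close> are those
  of \<open>\<omega>\<close>; the values of \<open>\<omega>\<close> on \<open>\<Lambda>\<close> are irrelevant.\<close>

definition ising_spec ::
    "'v set set \<Rightarrow> real \<Rightarrow> real \<Rightarrow> 'v set \<Rightarrow> ('v \<Rightarrow> spin) \<Rightarrow> ('v \<Rightarrow> spin) \<Rightarrow> real" where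
  "ising_spec E \<beta> lam \<Lambda> \<tau> \<omega> =
     ising_weight E \<beta> lam \<Lambda> (override_on \<omega> \<tau> \<Lambda>) /
     (\<Sum>\<tau>'\<in>configs \<Lambda>. ising_weight E \<beta> lam \<Lambda> (override_on \<omega> \<tau>' \<Lambda>))"

text \<open>The \<open>\<sigma>\<close>-algebra generated by the spins outside \<open>\<Lambda>\<close>.\<close>

definition outside_algebra :: "'v set \<Rightarrow> 'v set \<Rightarrow> ('v \<Rightarrow> spin) measure" where
  "outside_algebra V \<Lambda> =
     vimage_algebra (space (config_space V)) (\<lambda>\<omega>. restrict \<omega> (V - \<Lambda>)) (config_space (V - \<Lambda>))"

text \<open>Gibbs measures of the system on \<open>(V, E)\<close> in which the spins on \<open>S\<close> are fixed to \<open>\<sigma>\<close>;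
  \<open>S = {}\<close> is the unconditioned system.\<close>

definition ising_gibbs ::
    "'v set \<Rightarrow> 'v set set \<Rightarrow> real \<Rightarrow> real \<Rightarrow> 'v set \<Rightarrow> ('v \<Rightarrow> spin)
      \<Rightarrow> ('v \<Rightarrow> spin) measure \<Rightarrow> bool" where
  "ising_gibbs V E \<beta> lam S \<sigma> \<mu> \<longleftrightarrow>
     prob_space \<mu> \<and>
     sets \<mu> = sets (config_space V) \<and>
     (AE \<omega> in \<mu>. \<forall>v\<in>S. \<omega> v = \<sigma> v) \<and>
     (\<forall>\<Lambda>. finite \<Lambda> \<and> \<Lambda> \<subseteq> V - S \<longrightarrow>
        (\<forall>\<tau>\<in>configs \<Lambda>. AE \<omega> in \<mu>.
           real_cond_exp \<mu> (outside_algebra V \<Lambda>)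
             (indicat_real {\<omega>' \<in> space \<mu>. \<forall>v\<in>\<Lambda>. \<omega>' v = \<tau> v}) \<omega>
           = ising_spec E \<beta> lam \<Lambda> \<tau> \<omega>))"

definition prob_plus :: "('v \<Rightarrow> spin) measure \<Rightarrow> 'v \<Rightarrow> real" where
  "prob_plus \<mu> v = measure \<mu> {\<omega> \<in> space \<mu>. \<omega> v = Plus}"


section \<open>Spatial mixing on the infinite \<open>d\<close>-ary tree\<close>

text \<open>A vertex is the list of child indices on the path to it from the root \<open>[]\<close>.\<close>

definition tree_verts :: "nat \<Rightarrow> nat list set" where
  "tree_verts d = lists {..<d}"

definition tree_edges :: "nat \<Rightarrow> nat list set set" where
  "tree_edges d = {{v, v @ [i]} | v i. v \<in> tree_verts d \<and> i < d}"

abbreviation tree_gibbs ::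
    "nat \<Rightarrow> real \<Rightarrow> real \<Rightarrow> nat list set \<Rightarrow> (nat list \<Rightarrow> spin)
      \<Rightarrow> (nat list \<Rightarrow> spin) measure \<Rightarrow> bool" where
  "tree_gibbs d \<beta> lam \<equiv> ising_gibbs (tree_verts d) (tree_edges d) \<beta> lam"

definition weak_spatial_mixing :: "nat \<Rightarrow> real \<Rightarrow> real \<Rightarrow> bool" where
  "weak_spatial_mixing d \<beta> lam \<longleftrightarrow>
     (\<exists>C>0. \<exists>\<kappa>>0. \<forall>S \<sigma>\<^sub>1 \<sigma>\<^sub>2 \<mu>\<^sub>1 \<mu>\<^sub>2.
        S \<noteq> {} \<and> S \<subseteq> tree_verts d \<and>
        \<sigma>\<^sub>1 \<in> configs S \<and> \<sigma>\<^sub>2 \<in> configs S \<and>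
        tree_gibbs d \<beta> lam S \<sigma>\<^sub>1 \<mu>\<^sub>1 \<and> tree_gibbs d \<beta> lam S \<sigma>\<^sub>2 \<mu>\<^sub>2 \<longrightarrow>
        \<bar>prob_plus \<mu>\<^sub>1 [] - prob_plus \<mu>\<^sub>2 []\<bar>
          \<le> C * exp (- \<kappa> * real (set_graph_dist (tree_edges d) [] S)))"

definition strong_spatial_mixing :: "nat \<Rightarrow> real \<Rightarrow> real \<Rightarrow> bool" where
  "strong_spatial_mixing d \<beta> lam \<longleftrightarrow>
     (\<exists>C>0. \<exists>\<kappa>>0. \<forall>S T \<sigma>\<^sub>1 \<sigma>\<^sub>2 \<mu>\<^sub>1 \<mu>\<^sub>2.
        S \<noteq> {} \<and> S \<subseteq> tree_verts d \<and> T \<noteq> {} \<and> T \<subseteq> S \<and>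
        \<sigma>\<^sub>1 \<in> configs S \<and> \<sigma>\<^sub>2 \<in> configs S \<and> (\<forall>v\<in>S - T. \<sigma>\<^sub>1 v = \<sigma>\<^sub>2 v) \<and>
        tree_gibbs d \<beta> lam S \<sigma>\<^sub>1 \<mu>\<^sub>1 \<and> tree_gibbs d \<beta> lam S \<sigma>\<^sub>2 \<mu>\<^sub>2 \<longrightarrow>
        \<bar>prob_plus \<mu>\<^sub>1 [] - prob_plus \<mu>\<^sub>2 []\<bar>
          \<le> C * exp (- \<kappa> * real (set_graph_dist (tree_edges d) [] T)))"

end

(*
  In terms of y = log (P(-) / P(+)) the tree recursion is y = ln lam + (msg y_1 + ... + msg y_d) with
  msg odd and decreasing; for equal children it is the one-dimensional map f y = ln lam + d * msg y,
  with fixed point y*.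

  Fixing every spin outside a ball to + or to - gives f^n(+-infinity) at the root. These values lie on
  both sides of y*, so weak spatial mixing makes them converge to y* exponentially fast, which forces
  |f'(y* )| < 1.

  Conversely |f'(y* )| < 1 implies f'(y) * f'(f y) <= |f'(y* )| for all y. Measured in the metric
  sqrt |msg' y| dy, one step of the recursion multiplies distances by at most
  sqrt |msg' y| * (sqrt |msg' y_1| + ... + sqrt |msg' y_d|). Since sqrt |msg'| is a concave function of
  the message msg y, Jensen's inequality bounds this by its value at equal messages, that is, by
  sqrt (f'(y) * f'(f y)). Vertices with a fixed spin common to both systems contribute nothing, so the
  contraction rate is not affected by where they are.
*)
theory Submission
  imports Defs
begin

section \<open>The message recursion\<close>

text \<open>The bound \<open>d * slope ys < 1\<close> says nothing about the derivative away from
  the fixed point: \<open>slope\<close> is largest at 0, and a large \<open>lam\<close> moves the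
  fixed point far from 0, so a single step of the recursion may expand. Only the product over two
  consecutive steps is controlled, and the weight sqrt |msg'| shares that product between
  neighbouring levels. Pinned vertices make the tree irregular. Reading a fixed spin as an infinite
  field keeps the recursion uniform: its message is a limit value of \<open>msg\<close>, at which
  |msg'|, as a function of the message, vanishes. Thus Jensen's inequality can always run over all
  \<open>d\<close> children. The conditioned system may have several Gibbs measures. In each of them
  the root marginal is an average of finite-volume marginals over boundary conditions, and the
  contraction holds for every pair of boundary conditions, so the estimate covers every
  choice.\<close>

locale antiferro =
  fixes \<beta> :: real and d :: nat
  assumes beta_pos: "0 < \<beta>" and beta_less_1: "\<beta> < 1" and d_pos: "0 < d"
begin

text \<open>If \<open>y\<close> is the logarithm of the ratio \<open>P(-) / P(+)\<close> at a vertex in the subtree below it, then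
  \<open>msg y\<close> is its contribution to the logarithmic ratio at the parent.\<close>

definition msg :: "real \<Rightarrow> real" where
  "msg y = ln ((1 + \<beta> * exp y) / (\<beta> + exp y))"

definition slope :: "real \<Rightarrow> real" where
  "slope y = (1 - \<beta>\<^sup>2) / (1 + \<beta>\<^sup>2 + 2 * \<beta> * cosh y)"

text \<open>The quantity |msg'| as a function of the message instead of the field. The change of
  variable matters: on all of the real line \<open>sqrt (slope y)\<close> is positive, bounded and
  not constant, so it cannot be concave, while in the message it is.\<close>

definition msg_slope :: "real \<Rightarrow> real" where
  "msg_slope s = (1 + \<beta>\<^sup>2 - 2 * \<beta> * cosh s) / (1 - \<beta>\<^sup>2)"

definition step :: "real \<Rightarrow> real \<Rightarrow> real" where
  "step b y = b + d * msg y"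

text \<open>The limit of \<open>msg\<close> at minus infinity, hence the message of a vertex pinned
  to \<open>Plus\<close>.\<close>

definition bound :: real where
  "bound = - ln \<beta>"

lemma bound_pos: "0 < bound"
  using beta_pos beta_less_1 by (simp add: bound_def)

lemma beta_sq: "0 < 1 - \<beta>\<^sup>2"
  using beta_pos beta_less_1 by (simp add: power_less_one_iff)

lemma slope_denom: "0 < 1 + \<beta>\<^sup>2 + 2 * \<beta> * cosh y"
  using beta_pos cosh_real_pos[of y] by (simp add: add_pos_pos)

lemma slope_pos: "0 < slope y"
  unfolding slope_def using beta_sq slope_denom by simp

lemma slope_mono: "\<bar>y\<bar> \<le> \<bar>z\<bar> \<Longrightarrow> slope z \<le> slope y"
proof -
  assume "\<bar>y\<bar> \<le> \<bar>z\<bar>"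
  then have "cosh y \<le> cosh z"
    using cosh_real_nonneg_le_iff[of "\<bar>y\<bar>" "\<bar>z\<bar>"] by simp
  then show ?thesis
    unfolding slope_def using beta_pos beta_sq slope_denom
    by (intro divide_left_mono) auto
qed

lemma slope_minus [simp]: "slope (- y) = slope y"
  by (simp add: slope_def)

lemma slope_le_1: "slope y \<le> 1"
proof -
  have "1 - \<beta>\<^sup>2 \<le> 1 + \<beta>\<^sup>2 + 2 * \<beta> * cosh y"
    using beta_pos cosh_real_pos[of y] by (smt (verit) mult_nonneg_nonneg zero_le_power2)
  then show ?thesis unfolding slope_def using slope_denom by simp
qed

lemma msg_less: "\<bar>msg y\<bar> < bound"
proof -
  have e: "0 < exp y" by simp
  have b: "\<beta> * \<beta> < 1" using beta_sq by (simp add: power2_eq_square)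
  have "(1 + \<beta> * exp y) / (\<beta> + exp y) < 1 / \<beta>"
    using beta_pos e b by (simp add: divide_simps algebra_simps add_pos_pos)
  moreover have "\<beta> < (1 + \<beta> * exp y) / (\<beta> + exp y)"
    using beta_pos e b by (simp add: divide_simps algebra_simps add_pos_pos)
  ultimately have "msg y < ln (1 / \<beta>)" "ln \<beta> < msg y"
    unfolding msg_def using beta_pos e by (subst ln_less_cancel_iff; simp add: add_pos_pos)+
  then show ?thesis using beta_pos by (simp add: bound_def ln_div)
qed

lemma msg_minus [simp]: "msg (- y) = - msg y"
proof -
  have "(1 + \<beta> * exp (- y)) / (\<beta> + exp (- y)) = (\<beta> + exp y) / (1 + \<beta> * exp y)"
    using beta_pos by (simp add: exp_minus divide_simps add_pos_pos) (simp add: algebra_simps)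
  also have "ln \<dots> = - ln ((1 + \<beta> * exp y) / (\<beta> + exp y))"
    using beta_pos by (simp add: ln_div add_pos_pos)
  finally show ?thesis by (simp add: msg_def)
qed

lemma msg_0 [simp]: "msg 0 = 0"
  using beta_pos by (simp add: msg_def add.commute)

lemma DERIV_msg: "(msg has_real_derivative - slope y) (at y)"
proof -
  have p: "0 < 1 + \<beta> * exp y" "0 < \<beta> + exp y"
    using beta_pos by (simp_all add: add_pos_pos)
  have "(msg has_real_derivative
      \<beta> * exp y / (1 + \<beta> * exp y) - exp y / (\<beta> + exp y)) (at y)"
  proof -
    have "((\<lambda>y. ln (1 + \<beta> * exp y) - ln (\<beta> + exp y)) has_real_derivative
      \<beta> * exp y / (1 + \<beta> * exp y) - exp y / (\<beta> + exp y)) (at y)"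
      using p by (auto intro!: derivative_eq_intros)
    moreover have "msg = (\<lambda>y. ln (1 + \<beta> * exp y) - ln (\<beta> + exp y))"
    proof
      fix y
      have "0 < 1 + \<beta> * exp y" "0 < \<beta> + exp y"
        using beta_pos by (simp_all add: add_pos_pos)
      then show "msg y = ln (1 + \<beta> * exp y) - ln (\<beta> + exp y)"
        by (simp add: msg_def ln_div)
    qed
    ultimately show ?thesis by simp
  qed
  moreover have "\<beta> * exp y / (1 + \<beta> * exp y) - exp y / (\<beta> + exp y) = - slope y"
  proof -
    have "(1 + \<beta> * exp y) * (\<beta> + exp y) = exp y * (1 + \<beta>\<^sup>2 + 2 * \<beta> * cosh y)"
      by (simp add: cosh_field_def exp_minus field_simps power2_eq_square)
    then have "slope y = exp y * (1 - \<beta>\<^sup>2) / ((1 + \<beta> * exp y) * (\<beta> + exp y))"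
      by (simp add: slope_def)
    then show ?thesis using p
      by (simp add: divide_simps power2_eq_square) (simp add: algebra_simps)
  qed
  ultimately show ?thesis by simp
qed

lemma msg_antimono: "y < z \<Longrightarrow> msg z < msg y"
  by (rule DERIV_neg_imp_decreasing) (use DERIV_msg slope_pos in fastforce)+

lemma DERIV_step: "(step b has_real_derivative - (d * slope y)) (at y)"
  unfolding step_def [abs_def] by (auto intro!: derivative_eq_intros DERIV_msg)

lemma isCont_step: "isCont (step b) y"
  using DERIV_step DERIV_isCont by blast

lemma step_antimono: "y < z \<Longrightarrow> step b z < step b y"
  using msg_antimono d_pos by (simp add: step_def)

lemma step_bounds: "\<bar>step b y - b\<bar> < d * bound"
proof -
  have "\<bar>step b y - b\<bar> = d * \<bar>msg y\<bar>" by (simp add: step_def abs_mult)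
  also have "\<dots> < d * bound" using msg_less d_pos by simp
  finally show ?thesis .
qed

lemma DERIV_slope:
  "(slope has_real_derivative - (2 * \<beta> / (1 - \<beta>\<^sup>2) * sinh y * (slope y)\<^sup>2)) (at y)"
proof -
  have "(slope has_real_derivative
     - ((1 - \<beta>\<^sup>2) * (2 * \<beta> * sinh y)) / (1 + \<beta>\<^sup>2 + 2 * \<beta> * cosh y)\<^sup>2) (at y)"
    unfolding slope_def [abs_def] using slope_denom[of y]
    by (auto intro!: derivative_eq_intros simp: power2_eq_square)
  moreover have "(1 - \<beta>\<^sup>2) * (2 * \<beta> * sinh y) / (1 + \<beta>\<^sup>2 + 2 * \<beta> * cosh y)\<^sup>2 =
      2 * \<beta> / (1 - \<beta>\<^sup>2) * sinh y * (slope y)\<^sup>2"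
  proof -
    have "(1 - \<beta>\<^sup>2) * (2 * \<beta> * sinh y) = 2 * \<beta> / (1 - \<beta>\<^sup>2) * sinh y * (1 - \<beta>\<^sup>2)\<^sup>2"
      using beta_sq by (simp add: power2_eq_square[of "1 - \<beta>\<^sup>2"])
    then show ?thesis by (simp add: slope_def power_divide)
  qed
  ultimately show ?thesis by simp
qed

text \<open>In \<open>exp y\<close> the message is a fractional linear map, which gives the
  symmetric identity (1 + \<beta>^2 - 2 \<beta> cosh (msg y)) (1 + \<beta>^2 + 2 \<beta> cosh y) =
  (1 - \<beta>^2)^2. It turns the reciprocal of an affine function of cosh into an affine function
  of cosh.\<close>

lemma msg_slope_msg: "msg_slope (msg y) = slope y"
proof -
  have p: "0 < 1 + \<beta> * exp y" "0 < \<beta> + exp y"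
    using beta_pos by (simp_all add: add_pos_pos)
  have e: "(1 + \<beta> * exp y) * (\<beta> + exp y) = exp y * (1 + \<beta>\<^sup>2 + 2 * \<beta> * cosh y)"
    by (simp add: cosh_field_def exp_minus field_simps power2_eq_square)
  have "cosh (msg y) = ((1 + \<beta> * exp y) / (\<beta> + exp y) + (\<beta> + exp y) / (1 + \<beta> * exp y)) / 2"
    unfolding msg_def using p by (subst cosh_ln_real) auto
  also have "\<dots> = ((1 + \<beta> * exp y)\<^sup>2 + (\<beta> + exp y)\<^sup>2) / (2 * ((1 + \<beta> * exp y) * (\<beta> + exp y)))"
    using p by (simp add: divide_simps power2_eq_square)
  finally have c: "2 * \<beta> * cosh (msg y) * ((1 + \<beta> * exp y) * (\<beta> + exp y)) =
      \<beta> * ((1 + \<beta> * exp y)\<^sup>2 + (\<beta> + exp y)\<^sup>2)"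
    using p by simp
  have "(1 + \<beta>\<^sup>2 - 2 * \<beta> * cosh (msg y)) * ((1 + \<beta> * exp y) * (\<beta> + exp y)) =
      (1 - \<beta>\<^sup>2)\<^sup>2 * exp y"
    by (simp only: left_diff_distrib c) (simp add: algebra_simps power2_eq_square)
  then have "(1 + \<beta>\<^sup>2 - 2 * \<beta> * cosh (msg y)) * (1 + \<beta>\<^sup>2 + 2 * \<beta> * cosh y) = (1 - \<beta>\<^sup>2)\<^sup>2"
    unfolding e by simp
  then show ?thesis unfolding msg_slope_def slope_def using beta_sq slope_denom[of y]
    by (simp add: divide_simps power2_eq_square)
qed

text \<open>This is what lets pinned children enter the same estimates as free ones: their motion
  and their term in the Jensen sum are both zero.\<close>

lemma msg_slope_bound: "\<bar>s\<bar> = bound \<Longrightarrow> msg_slope s = 0"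
proof -
  assume s: "\<bar>s\<bar> = bound"
  have "cosh s = cosh \<bar>s\<bar>" by simp
  also have "\<dots> = cosh (ln \<beta>)" by (simp add: s bound_def)
  also have "\<dots> = (\<beta> + 1 / \<beta>) / 2" using beta_pos by (simp add: cosh_ln_real divide_simps)
  finally show ?thesis using beta_pos
    by (simp add: msg_slope_def field_simps power2_eq_square)
qed

lemma msg_surj: "\<bar>s\<bar> < bound \<Longrightarrow> \<exists>y. msg y = s"
proof -
  assume s: "\<bar>s\<bar> < bound"
  then have "s < - ln \<beta>" "ln \<beta> < s" by (auto simp: bound_def)
  then have "exp s < exp (- ln \<beta>)" "exp (ln \<beta>) < exp s" by (simp_all only: exp_less_cancel_iff)
  then have r: "exp s < 1 / \<beta>" "\<beta> < exp s" using beta_pos by (simp_all add: exp_minus divide_simps)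
  then have r': "0 < 1 - \<beta> * exp s" using beta_pos by (simp add: divide_simps mult.commute)
  \<comment> \<open>The inverse of the fractional linear map t -> (1 + \<beta> t) / (\<beta> + t),
    taken at \<open>exp s\<close>.\<close>
  define y where "y = ln ((1 - \<beta> * exp s) / (exp s - \<beta>))"
  have ey: "exp y = (1 - \<beta> * exp s) / (exp s - \<beta>)" unfolding y_def using r r' by simp
  have "1 + \<beta> * exp y = exp s * (1 - \<beta>\<^sup>2) / (exp s - \<beta>)"
    unfolding ey using r by (simp add: field_simps power2_eq_square)
  moreover have "\<beta> + exp y = (1 - \<beta>\<^sup>2) / (exp s - \<beta>)"
    unfolding ey using r by (simp add: field_simps power2_eq_square)
  ultimately have "(1 + \<beta> * exp y) / (\<beta> + exp y) = exp s"
    using r beta_sq by simp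
  then have "msg y = s" by (simp add: msg_def)
  then show ?thesis ..
qed

lemma msg_slope_nonneg: "\<bar>s\<bar> \<le> bound \<Longrightarrow> 0 \<le> msg_slope s"
  by (metis msg_slope_bound msg_slope_msg msg_surj slope_pos less_eq_real_def)

text \<open>\<open>msg_slope\<close> is a constant minus a positive multiple of the convex function
  cosh, hence concave; it is nonnegative on the interval, and the square root is concave and
  increasing.\<close>

lemma sqrt_msg_slope_concave: "concave_on {- bound..bound} (\<lambda>s. sqrt (msg_slope s))"
proof -
  have cosh: "cosh (u * x + v * y) \<le> u * cosh x + v * cosh y"
    if "u \<ge> 0" "v \<ge> 0" "u + v = 1" for u v x y :: real
  proof -
    have "convex_on UNIV (cosh :: real \<Rightarrow> real)"
      by (rule f''_ge0_imp_convex[where f' = sinh and f'' = cosh])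
        (auto intro!: derivative_eq_intros)
    then show ?thesis using that by (simp add: convex_on_def)
  qed
  show ?thesis unfolding concave_on_iff
  proof (intro conjI ballI allI impI)
    fix x y u v :: real
    assume *: "x \<in> {- bound..bound}" "y \<in> {- bound..bound}" "u \<ge> 0" "v \<ge> 0" "u + v = 1"
    have n: "0 \<le> msg_slope x" "0 \<le> msg_slope y"
      using * msg_slope_nonneg[of x] msg_slope_nonneg[of y] by auto
    have v: "v = 1 - u" using * by simp
    \<comment> \<open>The variance identity for two points: the square of the mean is the mean of
      the squares minus u v times the squared difference.\<close>
    have "(u * sqrt (msg_slope x) + v * sqrt (msg_slope y))\<^sup>2
      = u * (sqrt (msg_slope x))\<^sup>2 + v * (sqrt (msg_slope y))\<^sup>2
        - u * v * (sqrt (msg_slope x) - sqrt (msg_slope y))\<^sup>2"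
      unfolding v by (simp add: power2_eq_square algebra_simps)
    also have "\<dots> \<le> u * msg_slope x + v * msg_slope y"
      using * n by simp
    also have "\<dots> = (u * (1 + \<beta>\<^sup>2) + v * (1 + \<beta>\<^sup>2) - 2 * \<beta> * (u * cosh x + v * cosh y)) / (1 - \<beta>\<^sup>2)"
      by (simp add: msg_slope_def diff_divide_distrib add_divide_distrib algebra_simps)
    also have "\<dots> = (1 + \<beta>\<^sup>2 - 2 * \<beta> * (u * cosh x + v * cosh y)) / (1 - \<beta>\<^sup>2)"
      unfolding v by (simp add: algebra_simps)
    also have "\<dots> \<le> msg_slope (u *\<^sub>R x + v *\<^sub>R y)"
      unfolding msg_slope_def using cosh[of u v x y] * beta_sq beta_pos
      by (intro divide_right_mono) auto
    finally show "u * sqrt (msg_slope x) + v * sqrt (msg_slope y)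
        \<le> sqrt (msg_slope (u *\<^sub>R x + v *\<^sub>R y))"
      by (rule real_le_rsqrt)
  qed simp
qed

text \<open>Jensen's inequality. The right-hand side depends on the children only through their mean
  message, which is also all that the field of the parent depends on.\<close>

lemma sum_sqrt_msg_slope_le:
  assumes "\<And>i. i < d \<Longrightarrow> \<bar>s i\<bar> \<le> bound"
  shows "(\<Sum>i<d. sqrt (msg_slope (s i))) \<le> d * sqrt (msg_slope ((\<Sum>i<d. s i) / d))"
proof -
  have "(\<Sum>i<d. (1 / d) * sqrt (msg_slope (s i)))
      \<le> sqrt (msg_slope (\<Sum>i<d. (1 / d) *\<^sub>R s i))"
    by (rule concave_on_sum[OF _ _ sqrt_msg_slope_concave]) (use assms d_pos in \<open>auto simp: abs_le_iff minus_le_iff\<close>)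
  then show ?thesis using d_pos
    by (simp add: sum_divide_distrib[symmetric] pos_divide_le_eq mult.commute)
qed

section \<open>The fixed point and the derivative of two consecutive steps\<close>

lemma step_fixed_point: "\<exists>y. step b y = y"
proof -
  have "\<exists>x\<ge>b - d * bound. x \<le> b + d * bound \<and> x - step b x = 0"
  proof (rule IVT)
    show "b - d * bound - step b (b - d * bound) \<le> 0" "0 \<le> b + d * bound - step b (b + d * bound)"
      using step_bounds[of b "b - d * bound"] step_bounds[of b "b + d * bound"] by linarith+
    show "b - d * bound \<le> b + d * bound" using bound_pos by simp
  qed (auto intro!: continuous_intros isCont_step)
  then show ?thesis by (metis eq_iff_diff_eq_0)
qed

text \<open>Up to a negative constant factor, \<open>slope y * sinh y\<close> is the logarithmic
  derivative of \<open>slope\<close>, so this is log-concavity of \<open>slope\<close>. After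
  clearing denominators the difference is (1 + \<beta>^2) (sinh z - sinh y) + 2 \<beta> sinh (z -
  y).\<close>

lemma slope_sinh_mono: "y \<le> z \<Longrightarrow> slope y * sinh y \<le> slope z * sinh z"
proof -
  assume yz: "y \<le> z"
  have "sinh y * (1 + \<beta>\<^sup>2 + 2 * \<beta> * cosh z) \<le> sinh z * (1 + \<beta>\<^sup>2 + 2 * \<beta> * cosh y)"
  proof -
    have "0 \<le> (1 + \<beta>\<^sup>2) * (sinh z - sinh y) + 2 * \<beta> * sinh (z - y)"
      using yz beta_pos by (intro add_nonneg_nonneg mult_nonneg_nonneg) auto
    then show ?thesis unfolding sinh_diff by (simp add: algebra_simps)
  qed
  then show ?thesis unfolding slope_def using slope_denom[of y] slope_denom[of z] beta_sq
    by (simp add: divide_simps mult.commute mult.left_commute)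
qed

text \<open>The logarithmic derivative of the left-hand side in \<open>y\<close> is a negative multiple of
  \<open>slope y * Q y\<close> with \<open>Q\<close> increasing, so the maximum is attained at the zero of \<open>Q\<close>. There the
  product telescopes to \<open>d * slope yc * sinh yc / sinh (step b yc)\<close>.\<close>

lemma slope_step_le_aux:
  assumes b: "0 \<le> b" and fixp: "step b ys = ys" and less: "d * slope ys < 1"
  shows "(d * slope y) * (d * slope (step b y)) \<le> d * slope ys"
proof -
  have ys: "0 \<le> ys"
  proof (rule ccontr)
    assume "\<not> 0 \<le> ys"
    then have "0 \<le> msg ys" using msg_antimono[of ys 0] by simp
    then have "0 \<le> step b ys" using b by (simp add: step_def)
    then show False using fixp \<open>\<not> 0 \<le> ys\<close> by simp
  qed
  show ?thesis
  proof (cases "ys = 0")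
    case True
    \<comment> \<open>At \<open>ys = 0\<close> the slope is maximal, so one factor is bounded by
      \<open>d * slope ys\<close> and the other by 1.\<close>
    have le: "d * slope x \<le> d * slope ys" for x
      using slope_mono[of 0 x] True by (simp add: mult_left_mono)
    have "(d * slope y) * (d * slope (step b y)) \<le> (d * slope ys) * 1"
    proof (rule mult_mono)
      show "d * slope (step b y) \<le> 1" using le[of "step b y"] less by linarith
    qed (use le slope_pos less_imp_le in \<open>simp_all add: less_imp_le\<close>)
    then show ?thesis by simp
  next
    case False
    with ys have ys: "0 < ys" by simp
    define Q where "Q y = sinh y - d * (slope (step b y) * sinh (step b y))" for y
    have Q_mono: "Q x \<le> Q z" if "x \<le> z" for x z
    proof -
      have "step b z \<le> step b x" using step_antimono[of x z b] that by (cases "x = z") auto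
      then show ?thesis unfolding Q_def using that slope_sinh_mono
        by (intro diff_mono mult_left_mono) auto
    qed
    \<comment> \<open>\<open>less\<close> is exactly what makes \<open>Q ys\<close> nonnegative.
      Having the critical point below \<open>ys\<close> puts its image \<open>step b yc\<close>
      above \<open>ys\<close>, and the final comparison of the two sinh values uses both
      positions.\<close>
    have "\<exists>yc\<ge>0. yc \<le> ys \<and> Q yc = 0"
    proof (rule IVT)
      show "Q 0 \<le> 0" using b by (simp add: Q_def step_def slope_pos less_imp_le)
      have "Q ys = sinh ys * (1 - d * slope ys)" by (simp add: Q_def fixp algebra_simps)
      then show "0 \<le> Q ys" using ys less by simp
      have "isCont slope y" for y using DERIV_slope DERIV_isCont by blast
      then have "isCont Q x" for x unfolding Q_def
        by (auto intro!: continuous_intros isCont_step isCont_o2[OF isCont_step] isCont_sinh)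
      then show "\<forall>x. 0 \<le> x \<and> x \<le> ys \<longrightarrow> isCont Q x" by simp
    qed (use ys in auto)
    then obtain yc where yc: "0 \<le> yc" "yc \<le> ys" "Q yc = 0" by auto
    define P where "P y = slope y * slope (step b y)" for y
    have DP: "(P has_real_derivative
        - (2 * \<beta> / (1 - \<beta>\<^sup>2) * (slope x)\<^sup>2 * slope (step b x)) * Q x) (at x)" for x
      unfolding P_def [abs_def] Q_def
      by (rule derivative_eq_intros DERIV_slope DERIV_chain2[OF DERIV_slope DERIV_step] refl)+
        (simp add: algebra_simps power2_eq_square diff_divide_distrib)
    have c: "0 \<le> 2 * \<beta> / (1 - \<beta>\<^sup>2) * (slope x)\<^sup>2 * slope (step b x)" for x
      using beta_pos beta_sq slope_pos[of "step b x"] by simp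
    have "P y \<le> P yc"
    proof (cases "y \<le> yc")
      case True
      show ?thesis
      proof (rule DERIV_nonneg_imp_nondecreasing[OF True])
        fix x assume "y \<le> x" "x \<le> yc"
        then have "Q x \<le> 0" using Q_mono[of x yc] yc by simp
        then show "\<exists>y. (P has_real_derivative y) (at x) \<and> 0 \<le> y"
          using DP[of x] c[of x] by (meson mult_nonpos_nonpos neg_le_0_iff_le)
      qed
    next
      case False
      then have "yc \<le> y" by simp
      then show ?thesis
      proof (rule DERIV_nonpos_imp_nonincreasing)
        fix x assume "yc \<le> x" "x \<le> y"
        then have "0 \<le> Q x" using Q_mono[of yc x] yc by simp
        then show "\<exists>y. (P has_real_derivative y) (at x) \<and> y \<le> 0"
          using DP[of x] c[of x] by (meson mult_nonpos_nonneg neg_le_0_iff_le)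
      qed
    qed
    moreover have "d * d * P yc \<le> d * slope ys"
    proof -
      have w: "ys \<le> step b yc"
        using step_antimono[of yc ys b] yc fixp by (cases "yc = ys") auto
      have "d * d * P yc * sinh (step b yc) = d * (slope yc * sinh yc)"
        using yc(3) by (simp add: P_def Q_def algebra_simps)
      also have "\<dots> \<le> d * slope ys * sinh ys"
        using slope_sinh_mono[OF yc(2)] by (simp add: mult_left_mono mult.assoc)
      also have "\<dots> \<le> d * slope ys * sinh (step b yc)"
        using w slope_pos[of ys] by (intro mult_left_mono) auto
      finally show ?thesis using w ys
        by (metis mult_le_cancel_right_pos order.strict_trans2 sinh_real_pos_iff)
    qed
    moreover have "d * d * P y \<le> d * d * P yc"
      using calculation(1) by (intro mult_left_mono) auto
    ultimately show ?thesis by (simp add: P_def algebra_simps)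
  qed
qed

lemma slope_step_le:
  assumes fixp: "step b ys = ys" and less: "d * slope ys < 1"
  shows "(d * slope y) * (d * slope (step b y)) \<le> d * slope ys"
proof (cases "0 \<le> b")
  case True
  then show ?thesis using slope_step_le_aux assms by blast
next
  case False
  \<comment> \<open>Exchanging the two spins negates \<open>b\<close> and all fields, which reduces
    negative \<open>b\<close> to the case already done.\<close>
  have m: "step (- b) (- z) = - step b z" for z by (simp add: step_def)
  show ?thesis
    using slope_step_le_aux[of "- b" "- ys" "- y"] False assms m[of ys] m[of y] by simp
qed

text \<open>The contraction factor of one level when all children send the same message
  \<open>s\<close>. For |s| < \<open>bound\<close> some field \<open>y\<close> sends
  \<open>s\<close>, and the left side is the square root of the two-step derivative at
  \<open>y\<close>; at the endpoints no such field exists, but the left side is zero.\<close>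

lemma msg_slope_step_le:
  fixes b s :: real
  assumes fixp: "step b ys = ys" and less: "d * slope ys < 1" and s: "\<bar>s\<bar> \<le> bound"
  shows "d * sqrt (msg_slope s) * sqrt (slope (b + d * s)) \<le> sqrt (d * slope ys)"
proof (cases "\<bar>s\<bar> = bound")
  case True
  then show ?thesis using msg_slope_bound slope_pos[of ys] by simp
next
  case False
  then obtain y where y: "msg y = s" using s msg_surj[of s] by auto
  have "d * sqrt (msg_slope s) * sqrt (slope (b + d * s)) =
      sqrt ((d * slope y) * (d * slope (step b y)))"
    using y[symmetric] by (simp add: msg_slope_msg step_def real_sqrt_mult)
  also have "\<dots> \<le> sqrt (d * slope ys)"
    using slope_step_le[OF fixp less] by (rule real_sqrt_le_mono)
  finally show ?thesis .
qed

end

section \<open>Contraction of the message recursion\<close>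

context antiferro
begin

section \<open>From exponentially fast convergence to the derivative at the fixed point\<close>

definition plus_prob :: "real \<Rightarrow> real" where
  "plus_prob y = 1 / (1 + exp y)"

lemma DERIV_plus_prob: "(plus_prob has_real_derivative - (1 / (2 + 2 * cosh y))) (at y)"
proof -
  have p: "0 < 1 + exp y" by (simp add: add_pos_pos)
  have "(plus_prob has_real_derivative - exp y / (1 + exp y)\<^sup>2) (at y)"
    unfolding plus_prob_def [abs_def] using p
    by (auto intro!: derivative_eq_intros simp: power2_eq_square)
  moreover have "(1 + exp y)\<^sup>2 = exp y * (2 + 2 * cosh y)"
    by (simp add: cosh_field_def exp_minus field_simps power2_eq_square)
  ultimately show ?thesis by simp
qed

lemma plus_prob_lipschitz: "\<bar>plus_prob x - plus_prob y\<bar> \<le> \<bar>x - y\<bar>"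
proof -
  have "norm (plus_prob x - plus_prob y) \<le> 1 * norm (x - y)"
  proof (rule field_differentiable_bound[where S = UNIV and f' = "\<lambda>z. - (1 / (2 + 2 * cosh z))"])
    show "norm (- (1 / (2 + 2 * cosh z))) \<le> 1" for z :: real
      using cosh_real_ge_1[of z] by simp
  qed (auto simp: DERIV_plus_prob)
  then show ?thesis by simp
qed

text \<open>Mixing is stated for probabilities, convergence is needed for fields. Since
  \<open>plus_prob\<close> flattens at infinity, going back costs a constant that depends on the
  range of the fields.\<close>

lemma plus_prob_expanding:
  assumes "\<bar>x\<bar> \<le> m" "\<bar>y\<bar> \<le> m"
  shows "\<bar>x - y\<bar> \<le> (2 + 2 * cosh m) * \<bar>plus_prob x - plus_prob y\<bar>"
proof -
  have *: "\<bar>x - y\<bar> \<le> (2 + 2 * cosh m) * \<bar>plus_prob x - plus_prob y\<bar>"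
    if xy: "x < y" "\<bar>x\<bar> \<le> m" "\<bar>y\<bar> \<le> m" for x y
  proof -
    obtain z where z: "x < z" "z < y" "plus_prob y - plus_prob x = (y - x) * - (1 / (2 + 2 * cosh z))"
      using MVT2[OF xy(1), of plus_prob "\<lambda>z. - (1 / (2 + 2 * cosh z))"] DERIV_plus_prob by blast
    have "\<bar>z\<bar> \<le> m" using z xy by linarith
    then have "cosh z \<le> cosh m"
      using cosh_real_nonneg_le_iff[of "\<bar>z\<bar>" m] by simp
    then have c: "2 + 2 * cosh z \<le> 2 + 2 * cosh m" by simp
    have cz: "0 < 2 + 2 * cosh z" by (simp add: add_pos_pos)
    have "\<bar>plus_prob y - plus_prob x\<bar> = \<bar>y - x\<bar> / (2 + 2 * cosh z)"
      unfolding z(3) using cz by (simp add: abs_mult)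
    then have "\<bar>y - x\<bar> = (2 + 2 * cosh z) * \<bar>plus_prob y - plus_prob x\<bar>" using cz by simp
    also have "\<dots> \<le> (2 + 2 * cosh m) * \<bar>plus_prob y - plus_prob x\<bar>"
      by (intro mult_right_mono c) simp
    finally show ?thesis by (simp add: abs_minus_commute)
  qed
  show ?thesis
    using *[of x y] *[of y x] assms by (cases x y rule: linorder_cases) (auto simp: abs_minus_commute)
qed

text \<open>Along a convergent orbit the ratio of successive signed distances to \<open>ys\<close>
  tends to \<open>- (d * slope ys)\<close>. If the modulus were at least 1, the distances would
  eventually shrink by no more than a factor \<open>q\<close> per step, for any chosen
  \<open>q < 1\<close>. This also excludes the borderline modulus 1, at which convergence itself is
  not ruled out.\<close>

lemma slope_less_1_of_fast_convergence:
  assumes fixp: "step b ys = ys" and a: "\<And>n. a (Suc n) = step b (a n)" and a0: "a 0 \<noteq> ys"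
    and r: "0 < r" "r < 1" and conv: "\<And>n. \<bar>a n - ys\<bar> \<le> C * r ^ n"
  shows "d * slope ys < 1"
proof (rule ccontr)
  assume "\<not> d * slope ys < 1"
  then have ge: "1 \<le> d * slope ys" by simp
  \<comment> \<open>Any number strictly between \<open>r\<close> and 1: below 1 so that the ratios
    eventually exceed it in modulus, above \<open>r\<close> so that \<open>(q / r) ^ k\<close> is
    unbounded.\<close>
  define q where "q = (1 + r) / 2"
  have q: "r < q" "q < 1" "0 < q" using r by (auto simp: q_def)
  \<comment> \<open>\<open>step\<close> is strictly decreasing, so an orbit starting off
    \<open>ys\<close> never reaches it and the difference quotients make sense.\<close>
  have ne: "a n \<noteq> ys" for n
  proof (induction n)
    case (Suc n)
    then show ?case using step_antimono[of "a n" ys b] step_antimono[of ys "a n" b] fixp a[of n]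
      by (cases "a n" ys rule: linorder_cases) auto
  qed (use a0 in auto)
  have "(\<lambda>n. C * r ^ n) \<longlonglongrightarrow> 0"
    by (intro tendsto_mult_right_zero LIMSEQ_realpow_zero) (use r in auto)
  then have "(\<lambda>n. a n - ys) \<longlonglongrightarrow> 0"
    by (rule Lim_null_comparison[of _ "\<lambda>n. C * r ^ n", rotated]) (use conv in auto)
  then have lim: "a \<longlonglongrightarrow> ys" by (simp add: LIM_zero_iff)
  have "filterlim a (at ys) sequentially"
    using lim ne by (simp add: filterlim_at)
  moreover have "((\<lambda>y. (step b y - step b ys) / (y - ys)) \<longlongrightarrow> - (d * slope ys)) (at ys)"
    using DERIV_step[of b ys] by (simp add: has_field_derivative_iff)
  ultimately have "(\<lambda>n. (step b (a n) - step b ys) / (a n - ys)) \<longlonglongrightarrow> - (d * slope ys)"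
    by (rule filterlim_compose[rotated])
  then have "\<forall>\<^sub>F n in sequentially. (step b (a n) - step b ys) / (a n - ys) < - q"
    by (rule order_tendstoD) (use ge q in linarith)
  then obtain N where N: "\<And>n. n \<ge> N \<Longrightarrow> (a (Suc n) - ys) / (a n - ys) < - q"
    by (auto simp: eventually_sequentially a fixp)
  have exp1: "q * \<bar>a n - ys\<bar> \<le> \<bar>a (Suc n) - ys\<bar>" if "n \<ge> N" for n
  proof -
    have "q \<le> \<bar>(a (Suc n) - ys) / (a n - ys)\<bar>" using N[OF that] by linarith
    then show ?thesis using ne[of n] by (simp add: abs_divide pos_le_divide_eq)
  qed
  have lower: "q ^ k * \<bar>a N - ys\<bar> \<le> \<bar>a (N + k) - ys\<bar>" for k
  proof (induction k)
    case (Suc k)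
    have "q ^ Suc k * \<bar>a N - ys\<bar> \<le> q * \<bar>a (N + k) - ys\<bar>"
      using Suc q by (simp add: mult.assoc mult_left_mono)
    also have "\<dots> \<le> \<bar>a (N + Suc k) - ys\<bar>" using exp1[of "N + k"] by simp
    finally show ?case .
  qed simp
  have bd: "(q / r) ^ k \<le> C * r ^ N / \<bar>a N - ys\<bar>" for k
  proof -
    have "q ^ k * \<bar>a N - ys\<bar> \<le> C * r ^ N * r ^ k"
      using lower[of k] conv[of "N + k"] by (simp add: power_add mult.assoc)
    then show ?thesis using ne[of N] r by (simp add: divide_simps power_divide mult_ac)
  qed
  obtain k where "C * r ^ N / \<bar>a N - ys\<bar> < (q / r) ^ k"
    using real_arch_pow[of "q / r"] q r by auto
  then show False using bd[of k] by simp
qed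

lemma slope_less_1_of_mixing:
  assumes fixp: "step b ys = ys" and kappa: "0 < \<kappa>"
    and mix: "\<And>k. \<bar>plus_prob ((step b ^^ k) (b + d * bound)) - plus_prob ((step b ^^ k) (b - d * bound))\<bar>
      \<le> C * exp (- \<kappa> * real (Suc k))"
  shows "d * slope ys < 1"
proof -
  define m where "m = \<bar>b\<bar> + d * bound"
  define A where "A k = (step b ^^ k) (b + d * bound)" for k
  define B where "B k = (step b ^^ k) (b - d * bound)" for k
  have db: "0 < d * bound" using d_pos bound_pos by simp
  have ys: "b - d * bound < ys" "ys < b + d * bound"
    using step_bounds[of b ys] fixp by linarith+
  \<comment> \<open>The two orbits start on opposite sides of \<open>ys\<close> and swap sides at
    each step, so the distance of either one to \<open>ys\<close> is at most their mutual distance,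
    the only quantity that mixing controls.\<close>
  have sep: "A k < ys \<and> ys < B k \<or> B k < ys \<and> ys < A k" for k
  proof (induction k)
    case 0
    show ?case using ys by (simp add: A_def B_def)
  next
    case (Suc k)
    then show ?case
      using step_antimono[of "A k" ys b] step_antimono[of ys "A k" b]
        step_antimono[of "B k" ys b] step_antimono[of ys "B k" b] fixp
      by (auto simp: A_def B_def)
  qed
  have iter_bd: "\<bar>(step b ^^ k) y\<bar> \<le> m" if "\<bar>y - b\<bar> \<le> d * bound" for k y
  proof (cases k)
    case 0
    then show ?thesis using that unfolding m_def by simp
  next
    case (Suc j)
    then show ?thesis using step_bounds[of b "(step b ^^ j) y"] unfolding m_def by simp
  qed
  have "\<bar>A k - ys\<bar> \<le> ((2 + 2 * cosh m) * C * exp (- \<kappa>)) * exp (- \<kappa>) ^ k" for k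
  proof -
    have "\<bar>A k - ys\<bar> \<le> \<bar>A k - B k\<bar>" using sep[of k] by auto
    also have "\<dots> \<le> (2 + 2 * cosh m) * \<bar>plus_prob (A k) - plus_prob (B k)\<bar>"
      unfolding A_def B_def using db by (intro plus_prob_expanding iter_bd) auto
    also have "\<dots> \<le> (2 + 2 * cosh m) * (C * exp (- \<kappa> * real (Suc k)))"
      using mix[of k] unfolding A_def B_def by (intro mult_left_mono) (auto simp: add_nonneg_nonneg)
    also have "exp (- \<kappa> * real (Suc k)) = exp (- \<kappa>) * exp (- \<kappa>) ^ k"
      by (simp add: exp_of_nat_mult[symmetric] exp_add[symmetric] algebra_simps)
    finally show ?thesis by (simp add: mult.assoc)
  qed
  moreover have "A 0 \<noteq> ys" using ys by (simp add: A_def)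
  moreover have "A (Suc n) = step b (A n)" for n by (simp add: A_def)
  ultimately show ?thesis
    using kappa by (intro slope_less_1_of_fast_convergence[OF fixp, of A "exp (- \<kappa>)"]) auto
qed

text \<open>The message that \<open>v\<close> sends to its parent when \<open>k\<close> levels below \<open>v\<close> are kept: \<open>x\<close> gives
  the messages of the vertices on the last level, \<open>A\<close> is the set of free vertices, and a vertex outside
  \<open>A\<close> sends \<open>p v\<close>. Spin \<open>+\<close> corresponds to the message \<open>bound\<close>, spin \<open>-\<close> to \<open>- bound\<close>.\<close>

primrec tree_msg :: "real \<Rightarrow> nat list set \<Rightarrow> (nat list \<Rightarrow> real) \<Rightarrow> (nat list \<Rightarrow> real) \<Rightarrow> nat
    \<Rightarrow> nat list \<Rightarrow> real" where
  "tree_msg b A p x 0 v = x v"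
| "tree_msg b A p x (Suc k) v =
     (if v \<in> A then msg (b + (\<Sum>i<d. tree_msg b A p x k (v @ [i]))) else p v)"

definition tree_field :: "real \<Rightarrow> nat list set \<Rightarrow> (nat list \<Rightarrow> real) \<Rightarrow> (nat list \<Rightarrow> real) \<Rightarrow> nat
    \<Rightarrow> nat list \<Rightarrow> real" where
  "tree_field b A p x k v = b + (\<Sum>i<d. tree_msg b A p x k (v @ [i]))"

lemma tree_msg_Suc: "tree_msg b A p x (Suc k) v = (if v \<in> A then msg (tree_field b A p x k v) else p v)"
  by (simp add: tree_field_def)

lemma tree_msg_bounded:
  assumes "\<And>v. \<bar>p v\<bar> \<le> bound" "\<And>v. \<bar>x v\<bar> \<le> bound"
  shows "\<bar>tree_msg b A p x k v\<bar> \<le> bound"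
proof (cases k)
  case (Suc k)
  then show ?thesis using assms(1) msg_less by (simp add: tree_msg_Suc less_imp_le)
qed (use assms in simp)

lemma tree_field_bounded:
  assumes "\<And>v. \<bar>p v\<bar> \<le> bound" "\<And>v. \<bar>x v\<bar> \<le> bound"
  shows "\<bar>tree_field b A p x k v\<bar> \<le> \<bar>b\<bar> + d * bound"
proof -
  have "\<bar>\<Sum>i<d. tree_msg b A p x k (v @ [i])\<bar> \<le> (\<Sum>i<d. bound)"
    by (rule order.trans[OF sum_abs]) (intro sum_mono tree_msg_bounded assms)
  then show ?thesis unfolding tree_field_def by simp
qed

lemma segment_bounded:
  fixes a b c t :: real
  assumes "0 \<le> t" "t \<le> 1" "\<bar>a\<bar> \<le> c" "\<bar>b\<bar> \<le> c"
  shows "\<bar>(1 - t) * a + t * b\<bar> \<le> c"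
proof -
  have "\<bar>(1 - t) * a + t * b\<bar> \<le> (1 - t) * \<bar>a\<bar> + t * \<bar>b\<bar>"
    using assms by (intro order.trans[OF abs_triangle_ineq]) (simp add: abs_mult)
  also have "\<dots> \<le> (1 - t) * c + t * c"
    using assms by (intro add_mono mult_left_mono) auto
  finally show ?thesis by (simp add: algebra_simps)
qed

text \<open>The boundary messages move along a line segment. Measured with the weight
  \<^term>\<open>sqrt (slope y)\<close>, the speed of the field at a vertex is then multiplied by at most
  \<^term>\<open>sqrt (d * slope ys)\<close> per level: the weight turns the recursion into a sum of square roots of
  slopes, to which Jensen's inequality applies. Pinned vertices do not move, and their term vanishes.\<close>

lemma tree_field_deriv:
  assumes fixp: "step b ys = ys" and less: "d * slope ys < 1"
    and p: "\<And>v. \<bar>p v\<bar> = bound"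
    and x0: "\<And>v. \<bar>x0 v\<bar> \<le> bound" and x1: "\<And>v. \<bar>x1 v\<bar> \<le> bound"
    and t: "0 \<le> t" "t \<le> 1"
  defines "X \<equiv> \<lambda>t v. (1 - t) * x0 v + t * x1 v"
  shows "\<exists>D. ((\<lambda>t. tree_field b A p (X t) k v) has_real_derivative D) (at t) \<and>
     \<bar>D\<bar> * sqrt (slope (tree_field b A p (X t) k v)) \<le> 2 * d * bound * sqrt (d * slope ys) ^ k"
proof (induction k arbitrary: v)
  case 0
  have D: "((\<lambda>t. tree_field b A p (X t) 0 v) has_real_derivative (\<Sum>i<d. x1 (v @ [i]) - x0 (v @ [i]))) (at t)"
    unfolding tree_field_def X_def by (auto intro!: derivative_eq_intros sum.cong)
  \<comment> \<open>Origin of the constant: each of \<open>d\<close> boundary messages crosses an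
    interval of length at most \<open>2 * bound\<close>, and the weight is at most 1.\<close>
  have "\<bar>\<Sum>i<d. x1 (v @ [i]) - x0 (v @ [i])\<bar> \<le> (\<Sum>i<d. 2 * bound)"
  proof (intro order.trans[OF sum_abs] sum_mono)
    fix i
    show "\<bar>x1 (v @ [i]) - x0 (v @ [i])\<bar> \<le> 2 * bound"
      using x0[of "v @ [i]"] x1[of "v @ [i]"] by linarith
  qed
  then have "\<bar>\<Sum>i<d. x1 (v @ [i]) - x0 (v @ [i])\<bar> * sqrt (slope (tree_field b A p (X t) 0 v))
      \<le> (\<Sum>i<d. 2 * bound) * 1"
    using bound_pos slope_le_1 slope_pos
    by (intro mult_mono) (auto simp: less_imp_le)
  then show ?case using D by (auto simp: mult_ac)
next
  case (Suc k)
  let ?Y = "\<lambda>t v. tree_field b A p (X t) k v" and ?s = "\<lambda>i. tree_msg b A p (X t) (Suc k) (v @ [i])"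
  let ?M = "2 * d * bound * sqrt (d * slope ys) ^ k"
  have X: "\<bar>X t v\<bar> \<le> bound" for v
    unfolding X_def by (intro segment_bounded t x0 x1)
  have M: "0 \<le> ?M" using bound_pos slope_pos[of ys] by simp
  obtain D where D: "\<And>v. ((\<lambda>t. ?Y t v) has_real_derivative D v) (at t)"
    and D_le: "\<And>v. \<bar>D v\<bar> * sqrt (slope (?Y t v)) \<le> ?M"
    using Suc.IH by metis
  define E where "E i = (if v @ [i] \<in> A then - slope (?Y t (v @ [i])) * D (v @ [i]) else 0)" for i
  have E: "((\<lambda>t. tree_msg b A p (X t) (Suc k) (v @ [i])) has_real_derivative E i) (at t)" for i
    unfolding tree_msg_Suc E_def using DERIV_chain2[OF DERIV_msg D] by simp
  have DE: "((\<lambda>t. tree_field b A p (X t) (Suc k) v) has_real_derivative (\<Sum>i<d. E i)) (at t)"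
    unfolding tree_field_def by (auto intro!: derivative_eq_intros E simp del: tree_msg.simps)
  have s_le: "\<bar>?s i\<bar> \<le> bound" for i
    by (intro tree_msg_bounded) (use p X in auto)
  \<comment> \<open>The slope of \<open>msg\<close> is split into two square roots: one completes
    the weighted speed bounded by the induction hypothesis, the other becomes the concave function
    of the message.\<close>
  have E_le: "\<bar>E i\<bar> \<le> ?M * sqrt (msg_slope (?s i))" for i
  proof (cases "v @ [i] \<in> A")
    case True
    have "\<bar>E i\<bar> = \<bar>D (v @ [i])\<bar> * sqrt (slope (?Y t (v @ [i]))) * sqrt (slope (?Y t (v @ [i])))"
      using True slope_pos[of "?Y t (v @ [i])"] by (simp add: E_def abs_mult)
    also have "\<dots> \<le> ?M * sqrt (slope (?Y t (v @ [i])))"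
      using slope_pos by (intro mult_right_mono D_le) (simp add: less_imp_le)
    also have "slope (?Y t (v @ [i])) = msg_slope (?s i)"
      using True by (simp add: tree_msg_Suc msg_slope_msg del: tree_msg.simps)
    finally show ?thesis .
  next
    case False
    then show ?thesis using p by (simp add: E_def msg_slope_bound)
  qed
  define sb where "sb = (\<Sum>i<d. ?s i) / d"
  have field: "tree_field b A p (X t) (Suc k) v = b + d * sb"
    unfolding tree_field_def sb_def using d_pos by simp
  have sb_le: "\<bar>sb\<bar> \<le> bound"
  proof -
    have "\<bar>\<Sum>i<d. ?s i\<bar> \<le> (\<Sum>i<d. bound)"
      by (rule order.trans[OF sum_abs]) (intro sum_mono s_le)
    then show ?thesis using d_pos by (simp add: sb_def divide_le_eq mult.commute)
  qed
  have "\<bar>\<Sum>i<d. E i\<bar> \<le> (\<Sum>i<d. ?M * sqrt (msg_slope (?s i)))"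
    by (rule order.trans[OF sum_abs]) (intro sum_mono E_le)
  also have "\<dots> = ?M * (\<Sum>i<d. sqrt (msg_slope (?s i)))" by (rule sum_distrib_left[symmetric])
  also have "\<dots> \<le> ?M * (d * sqrt (msg_slope sb))"
    unfolding sb_def using M by (intro mult_left_mono sum_sqrt_msg_slope_le s_le)
  finally have "\<bar>\<Sum>i<d. E i\<bar> * sqrt (slope (b + d * sb)) \<le>
      ?M * (d * sqrt (msg_slope sb)) * sqrt (slope (b + d * sb))"
    using slope_pos[of "b + d * sb"] by (intro mult_right_mono) simp_all
  also have "\<dots> = ?M * (d * sqrt (msg_slope sb) * sqrt (slope (b + d * sb)))"
    by (simp only: mult.assoc)
  also have "\<dots> \<le> ?M * sqrt (d * slope ys)"
    by (rule mult_left_mono[OF msg_slope_step_le[OF fixp less sb_le] M])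
  finally have "\<bar>\<Sum>i<d. E i\<bar> * sqrt (slope (tree_field b A p (X t) (Suc k) v)) \<le>
      ?M * sqrt (d * slope ys)"
    using field by simp
  then show ?case using DE by (intro exI[of _ "\<Sum>i<d. E i"]) (simp add: mult.commute mult.left_commute)
qed

text \<open>The mean value inequality along the segment. The weight can be divided out because
  fields stay within |b| + \<open>d * bound\<close>, where \<open>slope\<close> is bounded below by
  its value at that endpoint.\<close>

lemma tree_field_contraction:
  assumes fixp: "step b ys = ys" and less: "d * slope ys < 1"
    and p: "\<And>v. \<bar>p v\<bar> = bound"
    and x0: "\<And>v. \<bar>x0 v\<bar> \<le> bound" and x1: "\<And>v. \<bar>x1 v\<bar> \<le> bound"
  shows "\<bar>tree_field b A p x0 k v - tree_field b A p x1 k v\<bar>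
    \<le> 2 * d * bound / sqrt (slope (\<bar>b\<bar> + d * bound)) * sqrt (d * slope ys) ^ k"
proof -
  define X where "X = (\<lambda>t v. (1 - t) * x0 v + t * x1 v)"
  define Y where "Y t = tree_field b A p (X t) k v" for t
  let ?c = "sqrt (slope (\<bar>b\<bar> + d * bound))" and ?M = "2 * d * bound * sqrt (d * slope ys) ^ k"
  have c: "0 < ?c" using slope_pos by simp
  have bnd: "\<bar>X t v\<bar> \<le> bound" if "0 \<le> t" "t \<le> 1" for t v
    unfolding X_def by (intro segment_bounded that x0 x1)
  have "\<exists>D. (Y has_real_derivative D) (at t) \<and> \<bar>D\<bar> \<le> ?M / ?c" if t: "t \<in> {0..1}" for t
  proof -
    obtain D where D: "(Y has_real_derivative D) (at t)" "\<bar>D\<bar> * sqrt (slope (Y t)) \<le> ?M"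
      using tree_field_deriv[of b ys p x0 x1 t A k v, OF fixp less p x0 x1] t
      unfolding Y_def X_def by auto
    have "\<bar>Y t\<bar> \<le> \<bar>b\<bar> + d * bound"
      unfolding Y_def using p bnd t by (intro tree_field_bounded) auto
    then have "?c \<le> sqrt (slope (Y t))"
      by (intro real_sqrt_le_mono slope_mono) linarith
    then have "\<bar>D\<bar> * ?c \<le> ?M" using D(2) by (meson abs_ge_zero mult_left_mono order.trans)
    then show ?thesis using D(1) c by (auto simp: pos_le_divide_eq)
  qed
  then have "\<forall>t\<in>{0..1}. \<exists>D. (Y has_real_derivative D) (at t) \<and> \<bar>D\<bar> \<le> ?M / ?c" by blast
  from bchoice[OF this] obtain D
    where D: "\<forall>t\<in>{0..1}. (Y has_real_derivative D t) (at t) \<and> \<bar>D t\<bar> \<le> ?M / ?c" ..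
  have "norm (Y 0 - Y 1) \<le> ?M / ?c * norm (0 - 1 :: real)"
  proof (rule field_differentiable_bound[where S = "{0..1}" and f' = D])
    show "(Y has_real_derivative D t) (at t within {0..1})" if "t \<in> {0..1}" for t
      using D that by (blast intro: has_field_derivative_at_within)
    show "norm (D t) \<le> ?M / ?c" if "t \<in> {0..1}" for t
      using D that by simp
  qed auto
  then show ?thesis by (simp add: Y_def X_def)
qed

end

section \<open>Partition functions on the tree\<close>

lemma sum_spin: "(\<Sum>s\<in>(UNIV :: spin set). f s) = f Plus + f Minus" for f :: "spin \<Rightarrow> real"
proof -
  have "(UNIV :: spin set) = {Plus, Minus}" using spin.exhaust by auto
  then have "(\<Sum>s\<in>UNIV. f s) = sum f {Plus, Minus}" by (rule arg_cong)
  then show ?thesis by simp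
qed

lemma finite_configs [simp]: "finite A \<Longrightarrow> finite (configs A)"
  unfolding configs_def by (rule finite_PiE) auto

lemma restrict_in_configs [simp]: "restrict \<omega> A \<in> configs A"
  by (simp add: configs_def)

lemma configs_eqI:
  "\<eta> \<in> configs A \<Longrightarrow> \<eta>' \<in> configs A \<Longrightarrow> (\<And>v. v \<in> A \<Longrightarrow> \<eta> v = \<eta>' v) \<Longrightarrow> \<eta> = \<eta>'"
  unfolding configs_def by (rule PiE_ext)

lemma sum_configs_Un:
  fixes F :: "('v \<Rightarrow> spin) \<Rightarrow> real"
  assumes "A \<inter> B = {}"
  shows "(\<Sum>\<omega>\<in>configs (A \<union> B). F \<omega>) = (\<Sum>\<eta>\<in>configs A. \<Sum>\<tau>\<in>configs B. F (override_on \<eta> \<tau> B))"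
  unfolding sum.cartesian_product
  by (rule sum.reindex_bij_witness[where i = "\<lambda>(\<eta>, \<tau>). override_on \<eta> \<tau> B"
        and j = "\<lambda>\<omega>. (restrict \<omega> A, restrict \<omega> B)"])
    (use assms in \<open>force simp: configs_def PiE_def extensional_def override_on_def fun_eq_iff
        intro!: arg_cong[where f = F]\<close>)+

section \<open>Balls of the tree and summation over their last level\<close>

definition tree_ball :: "nat \<Rightarrow> nat \<Rightarrow> nat list set" where
  "tree_ball d n = {v \<in> tree_verts d. length v \<le> n}"

definition tree_level :: "nat \<Rightarrow> nat \<Rightarrow> nat list set" where
  "tree_level d n = {v \<in> tree_verts d. length v = n}"

lemma finite_tree_ball [simp]: "finite (tree_ball d n)"
  using finite_lists_length_le[of "{..<d}" n]
  by (simp add: tree_ball_def tree_verts_def lists_eq_set)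

lemma finite_tree_level [simp]: "finite (tree_level d n)"
  by (rule finite_subset[OF _ finite_tree_ball[of d n]]) (auto simp: tree_ball_def tree_level_def)

lemma Nil_in_tree_ball [simp]: "[] \<in> tree_ball d n"
  by (simp add: tree_ball_def tree_verts_def)

lemma butlast_in_tree_verts: "v \<in> tree_verts d \<Longrightarrow> butlast v \<in> tree_verts d"
  by (auto simp: tree_verts_def dest: in_set_butlastD)

lemma prod_tree_level_Suc:
  fixes f :: "nat list \<Rightarrow> real"
  shows "(\<Prod>v\<in>tree_level d (Suc n). f v) = (\<Prod>u\<in>tree_level d n. \<Prod>i<d. f (u @ [i]))"
  unfolding prod.cartesian_product
proof (rule prod.reindex_bij_witness[where i = "\<lambda>(u, i). u @ [i]" and j = "\<lambda>v. (butlast v, last v)"])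
  fix v assume "v \<in> tree_level d (Suc n)"
  then have v: "v \<noteq> []" "v \<in> tree_verts d" "length v = Suc n" by (auto simp: tree_level_def)
  then have "last v < d" by (metis last_in_set tree_verts_def in_listsD lessThan_iff)
  then show "(butlast v, last v) \<in> tree_level d n \<times> {..<d}"
    using v butlast_in_tree_verts by (auto simp: tree_level_def)
  show "(case (butlast v, last v) of (u, i) \<Rightarrow> u @ [i]) = v" using v by simp
  show "(case (butlast v, last v) of (u, i) \<Rightarrow> f (u @ [i])) = f v" using v by simp
qed (auto simp: tree_level_def tree_verts_def)

definition edge_weight :: "real \<Rightarrow> spin \<Rightarrow> spin \<Rightarrow> real" where
  "edge_weight \<beta> s s' = (if s = s' then \<beta> else 1)"

text \<open>The vertex weights \<open>q\<close> are left arbitrary so that they can hold both pins,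
  as zero weights, and the partition functions of subtrees already summed out. An edge is indexed by
  its lower endpoint, hence the root is left out of the second product.\<close>

definition ball_weight :: "nat \<Rightarrow> real \<Rightarrow> (nat list \<Rightarrow> spin \<Rightarrow> real) \<Rightarrow> nat \<Rightarrow> (nat list \<Rightarrow> spin) \<Rightarrow> real" where
  "ball_weight d \<beta> q n \<omega> = (\<Prod>v\<in>tree_ball d n. q v (\<omega> v)) *
     (\<Prod>v\<in>tree_ball d n - {[]}. edge_weight \<beta> (\<omega> (butlast v)) (\<omega> v))"

definition ball_sum :: "nat \<Rightarrow> real \<Rightarrow> (nat list \<Rightarrow> spin \<Rightarrow> real) \<Rightarrow> nat \<Rightarrow> spin \<Rightarrow> real" where
  "ball_sum d \<beta> q n s = (\<Sum>\<omega>\<in>configs (tree_ball d n). if \<omega> [] = s then ball_weight d \<beta> q n \<omega> else 0)"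

text \<open>The partition function of the first \<open>k\<close> levels below \<open>v\<close>, with
  the spin at \<open>v\<close> fixed to \<open>s\<close>.\<close>

primrec node_weight ::
    "nat \<Rightarrow> real \<Rightarrow> (nat list \<Rightarrow> spin \<Rightarrow> real) \<Rightarrow> nat \<Rightarrow> nat list \<Rightarrow> spin \<Rightarrow> real" where
  "node_weight d \<beta> q 0 v s = q v s"
| "node_weight d \<beta> q (Suc k) v s =
     q v s * (\<Prod>i<d. \<Sum>s'\<in>UNIV. edge_weight \<beta> s s' * node_weight d \<beta> q k (v @ [i]) s')"

lemma ball_sum_cong:
  assumes "\<And>v s. v \<in> tree_ball d n \<Longrightarrow> q v s = q' v s"
  shows "ball_sum d \<beta> q n s = ball_sum d \<beta> q' n s"
  unfolding ball_sum_def ball_weight_def using assms by (intro sum.cong) auto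

text \<open>Given the spins above, the vertices of the last level are independent, so their sum
  factorises and each factor is absorbed into the weight of the parent.\<close>

lemma ball_sum_Suc:
  "ball_sum d \<beta> q (Suc n) s = ball_sum d \<beta>
     (\<lambda>v s. if length v = n then q v s * (\<Prod>i<d. \<Sum>s'\<in>UNIV. edge_weight \<beta> s s' * q (v @ [i]) s') else q v s) n s"
proof -
  let ?B = "tree_ball d n" and ?L = "tree_level d (Suc n)"
  let ?P = "\<lambda>v s. \<Prod>i<d. \<Sum>s'\<in>UNIV. edge_weight \<beta> s s' * q (v @ [i]) s'"
  let ?e = "\<lambda>\<omega> v. edge_weight \<beta> (\<omega> (butlast v)) (\<omega> v)"
  have ball: "tree_ball d (Suc n) = ?B \<union> ?L" and disj: "?B \<inter> ?L = {}"
    by (auto simp: tree_ball_def tree_level_def)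
  have notL: "v \<notin> ?L" if "v \<in> ?B" for v using that disj by blast
  have w: "ball_weight d \<beta> q (Suc n) (override_on \<eta> \<tau> ?L) = ball_weight d \<beta> q n \<eta> *
      (\<Prod>v\<in>?L. edge_weight \<beta> (\<eta> (butlast v)) (\<tau> v) * q v (\<tau> v))" for \<eta> \<tau>
  proof -
    have "(\<Prod>v\<in>?B \<union> ?L. q v (override_on \<eta> \<tau> ?L v)) = (\<Prod>v\<in>?B. q v (\<eta> v)) * (\<Prod>v\<in>?L. q v (\<tau> v))"
      using disj notL by (subst prod.union_disjoint) (auto intro!: arg_cong2[where f = "(*)"] prod.cong)
    moreover have "(\<Prod>v\<in>(?B \<union> ?L) - {[]}. ?e (override_on \<eta> \<tau> ?L) v) =
      (\<Prod>v\<in>?B - {[]}. ?e \<eta> v) * (\<Prod>v\<in>?L. edge_weight \<beta> (\<eta> (butlast v)) (\<tau> v))"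
    proof -
      have "(?B \<union> ?L) - {[]} = (?B - {[]}) \<union> ?L" by (auto simp: tree_level_def)
      moreover have "v \<in> ?B - {[]} \<Longrightarrow> v \<notin> ?L \<and> butlast v \<notin> ?L" "v \<in> ?L \<Longrightarrow> butlast v \<notin> ?L" for v
        by (auto simp: tree_ball_def tree_level_def)
      ultimately show ?thesis using disj
        by (simp, subst prod.union_disjoint) (auto intro!: arg_cong2[where f = "(*)"] prod.cong)
    qed
    ultimately show ?thesis unfolding ball_weight_def ball prod.distrib by (simp add: mult_ac)
  qed
  have "ball_sum d \<beta> q (Suc n) s = (\<Sum>\<eta>\<in>configs ?B. \<Sum>\<tau>\<in>configs ?L.
      if \<eta> [] = s then ball_weight d \<beta> q n \<eta> *
        (\<Prod>v\<in>?L. edge_weight \<beta> (\<eta> (butlast v)) (\<tau> v) * q v (\<tau> v)) else 0)"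
    unfolding ball_sum_def ball sum_configs_Un[OF disj] w
    by (intro sum.cong refl) (auto simp: override_on_def tree_level_def)
  also have "\<dots> = (\<Sum>\<eta>\<in>configs ?B. if \<eta> [] = s then ball_weight d \<beta> q n \<eta> *
      (\<Sum>\<tau>\<in>configs ?L. \<Prod>v\<in>?L. edge_weight \<beta> (\<eta> (butlast v)) (\<tau> v) * q v (\<tau> v)) else 0)"
    by (intro sum.cong refl) (simp add: sum_distrib_left)
  also have "\<dots> = (\<Sum>\<eta>\<in>configs ?B. if \<eta> [] = s then ball_weight d \<beta> q n \<eta> *
      (\<Prod>v\<in>?L. \<Sum>s'\<in>UNIV. edge_weight \<beta> (\<eta> (butlast v)) s' * q v s') else 0)"
    unfolding configs_def by (subst prod_sum_PiE) auto
  also have "\<dots> = (\<Sum>\<eta>\<in>configs ?B. if \<eta> [] = s then ball_weight d \<beta> q n \<eta> *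
      (\<Prod>v\<in>tree_level d n. ?P v (\<eta> v)) else 0)"
    unfolding prod_tree_level_Suc by (intro sum.cong refl if_cong) simp
  also have "\<dots> = ball_sum d \<beta> (\<lambda>v s. if length v = n then q v s * ?P v s else q v s) n s"
    unfolding ball_sum_def
  proof (intro sum.cong refl if_cong)
    fix \<eta>
    have "(\<Prod>v\<in>tree_level d n. ?P v (\<eta> v)) = (\<Prod>v\<in>?B. if length v = n then ?P v (\<eta> v) else 1)"
      by (rule prod.mono_neutral_cong_left[OF finite_tree_ball]) (auto simp: tree_ball_def tree_level_def)
    moreover have "(\<Prod>v\<in>?B. if length v = n then q v (\<eta> v) * ?P v (\<eta> v) else q v (\<eta> v)) =
        (\<Prod>v\<in>?B. q v (\<eta> v)) * (\<Prod>v\<in>?B. if length v = n then ?P v (\<eta> v) else 1)"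
      unfolding prod.distrib[symmetric] by (rule prod.cong) auto
    ultimately show "ball_weight d \<beta> q n \<eta> * (\<Prod>v\<in>tree_level d n. ?P v (\<eta> v)) =
        ball_weight d \<beta> (\<lambda>v s. if length v = n then q v s * ?P v s else q v s) n \<eta>"
      unfolding ball_weight_def by simp
  qed
  finally show ?thesis .
qed

text \<open>Removing levels from the leaves upwards always leaves a ball around the root, so
  subtrees never have to be relabelled as trees of their own.\<close>

lemma ball_sum_peel:
  "j \<le> n \<Longrightarrow> ball_sum d \<beta> q n s =
     ball_sum d \<beta> (\<lambda>v. if length v = n - j then node_weight d \<beta> q j v else q v) (n - j) s"
proof (induction j)
  case 0
  show ?case by (auto intro!: ball_sum_cong)
next
  case (Suc j)
  define m where "m = n - Suc j"
  have m: "n - j = Suc m" using Suc.prems by (simp add: m_def)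
  have "ball_sum d \<beta> q n s =
      ball_sum d \<beta> (\<lambda>v. if length v = Suc m then node_weight d \<beta> q j v else q v) (Suc m) s"
    using Suc m by simp
  also have "\<dots> = ball_sum d \<beta> (\<lambda>v. if length v = m then node_weight d \<beta> q (Suc j) v else q v) m s"
    unfolding ball_sum_Suc by (rule ball_sum_cong) (auto simp: tree_ball_def)
  finally show ?case by (simp add: m_def)
qed

lemma ball_sum_eq_node_weight: "ball_sum d \<beta> q n s = node_weight d \<beta> q n [] s"
proof -
  have b0: "tree_ball d 0 = {[]}" by (auto simp: tree_ball_def tree_verts_def)
  have "ball_sum d \<beta> q n s = ball_sum d \<beta> (\<lambda>v. if v = [] then node_weight d \<beta> q n v else q v) 0 s"
    using ball_sum_peel[of n n] by simp
  \<comment> \<open>A sum over configurations of one vertex, written as a sum of one-factor products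
    so that sum and product can be exchanged.\<close>
  also have "\<dots> = (\<Sum>\<omega>\<in>configs {[]}. \<Prod>v\<in>{[]}. if \<omega> v = s then node_weight d \<beta> q n v (\<omega> v) else 0)"
    unfolding ball_sum_def ball_weight_def b0 by (intro sum.cong) auto
  also have "\<dots> = (\<Prod>v\<in>{[]}. \<Sum>s'\<in>UNIV. if s' = s then node_weight d \<beta> q n v s' else 0)"
    unfolding configs_def by (subst prod_sum_PiE) auto
  also have "\<dots> = node_weight d \<beta> q n [] s" by simp
  finally show ?thesis .
qed

text \<open>Edges correspond to their lower endpoints: of {butlast v, v} the longer list is
  \<open>v\<close>. The strict depth bound on \<open>A\<close> keeps the children of
  \<open>A\<close> inside the ball of radius \<open>n\<close>.\<close>

lemma ising_weight_tree:
  assumes A: "A \<subseteq> {v \<in> tree_verts d. length v < n}"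
  shows "ising_weight (tree_edges d) \<beta> lam A \<omega> = (\<Prod>v\<in>A. if \<omega> v = Minus then lam else 1) *
    (\<Prod>v\<in>{v \<in> tree_ball d n - {[]}. v \<in> A \<or> butlast v \<in> A}. edge_weight \<beta> (\<omega> (butlast v)) (\<omega> v))"
proof -
  let ?W = "{v \<in> tree_ball d n - {[]}. v \<in> A \<or> butlast v \<in> A}"
  have finA: "finite A"
    by (rule finite_subset[OF _ finite_tree_ball[of d n]]) (use A in \<open>auto simp: tree_ball_def\<close>)
  have minus: "(\<Prod>v\<in>A. if \<omega> v = Minus then lam else 1) = lam ^ num_minus A \<omega>"
    using finA by (simp add: prod.If_cases num_minus_def Int_def)
  have edges: "{e \<in> tree_edges d. e \<inter> A \<noteq> {} \<and> (\<forall>u\<in>e. \<forall>v\<in>e. \<omega> u = \<omega> v)} =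
      (\<lambda>v. {butlast v, v}) ` {v \<in> ?W. \<omega> (butlast v) = \<omega> v}" (is "?E = ?f ` ?V")
  proof (intro equalityI subsetI)
    fix e assume e: "e \<in> ?E"
    then have "e \<in> tree_edges d" by blast
    then obtain u i where u: "e = {u, u @ [i]}" "u \<in> tree_verts d" "i < d"
      unfolding tree_edges_def by blast
    have "u \<in> A \<or> u @ [i] \<in> A" "\<omega> u = \<omega> (u @ [i])" using e unfolding u(1) by blast+
    moreover from this(1) have "length u < n" using A by auto
    ultimately have "u @ [i] \<in> ?V" using u by (auto simp: tree_ball_def tree_verts_def)
    then show "e \<in> ?f ` ?V" using u by (auto intro!: image_eqI[of _ _ "u @ [i]"])
  next
    fix e assume "e \<in> ?f ` ?V"
    then obtain v where v: "e = {butlast v, v}" "v \<in> ?V" by auto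
    then have ne: "v \<noteq> []" "v \<in> tree_verts d" by (auto simp: tree_ball_def)
    then have "last v < d" "butlast v \<in> tree_verts d"
      by (metis last_in_set tree_verts_def in_listsD lessThan_iff, simp add: butlast_in_tree_verts)
    moreover have "e = {butlast v, butlast v @ [last v]}" using ne v by simp
    ultimately have "e \<in> tree_edges d" unfolding tree_edges_def by blast
    moreover have "butlast v \<in> A \<or> v \<in> A" and eq: "\<omega> (butlast v) = \<omega> v" using v(2) by blast+
    then have "e \<inter> A \<noteq> {}" using v(1) by auto
    moreover have "\<forall>u\<in>e. \<forall>w\<in>e. \<omega> u = \<omega> w" using eq v(1) by simp
    ultimately show "e \<in> ?E" by (intro CollectI conjI)
  qed
  have inj: "inj_on ?f ?V"
  proof (rule inj_onI)
    fix v w assume vw: "v \<in> ?V" "w \<in> ?V" "?f v = ?f w"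
    then have "v \<noteq> []" "w \<noteq> []" by auto
    then have "length (butlast v) < length v" "length (butlast w) < length w" by auto
    then show "v = w" using vw(3) by (metis doubleton_eq_iff less_asym)
  qed
  have "(\<Prod>v\<in>?W. edge_weight \<beta> (\<omega> (butlast v)) (\<omega> v)) = \<beta> ^ card ?V"
    by (simp add: edge_weight_def prod.If_cases Int_def)
  also have "card ?V = num_equal_edges (tree_edges d) A \<omega>"
    unfolding num_equal_edges_def edges by (rule card_image[OF inj, symmetric])
  finally show ?thesis unfolding ising_weight_def minus by simp
qed

section \<open>Partition functions in terms of messages\<close>

locale antiferro_tree = antiferro +
  fixes lam :: real
  assumes lam_pos: "0 < lam"
begin

definition spin_msg :: "spin \<Rightarrow> real" where
  "spin_msg s = (if s = Plus then bound else - bound)"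

lemma abs_spin_msg [simp]: "\<bar>spin_msg s\<bar> = bound"
  using bound_pos by (simp add: spin_msg_def)

lemma exp_bound: "exp bound = 1 / \<beta>" "exp (- bound) = \<beta>"
  using beta_pos by (simp_all add: bound_def exp_minus divide_simps)

definition vertex_weight :: "nat list set \<Rightarrow> (nat list \<Rightarrow> spin) \<Rightarrow> nat list \<Rightarrow> spin \<Rightarrow> real" where
  "vertex_weight A \<omega> v s =
     (if v \<in> A then if s = Minus then lam else 1 else if s = \<omega> v then 1 else 0)"

text \<open>The weight of the branch at \<open>v\<close> as seen from a parent with spin
  \<open>s\<close>; the message of \<open>v\<close> is the logarithm of its ratio
  \<open>Minus\<close> to \<open>Plus\<close>.\<close>

definition edge_sum :: "nat list set \<Rightarrow> (nat list \<Rightarrow> spin) \<Rightarrow> nat \<Rightarrow> nat list \<Rightarrow> spin \<Rightarrow> real" where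
  "edge_sum A \<omega> k v s =
     (\<Sum>s'\<in>UNIV. edge_weight \<beta> s s' * node_weight d \<beta> (vertex_weight A \<omega>) k v s')"

lemma node_weight_Suc:
  "node_weight d \<beta> (vertex_weight A \<omega>) (Suc k) v s = vertex_weight A \<omega> v s * (\<Prod>i<d. edge_sum A \<omega> k (v @ [i]) s)"
  by (simp add: edge_sum_def)

abbreviation spin_field :: "nat list set \<Rightarrow> (nat list \<Rightarrow> spin) \<Rightarrow> nat \<Rightarrow> nat list \<Rightarrow> real" where
  "spin_field A \<omega> \<equiv> tree_field (ln lam) A (\<lambda>v. spin_msg (\<omega> v)) (\<lambda>v. spin_msg (\<omega> v))"

abbreviation spin_tree_msg :: "nat list set \<Rightarrow> (nat list \<Rightarrow> spin) \<Rightarrow> nat \<Rightarrow> nat list \<Rightarrow> real" where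
  "spin_tree_msg A \<omega> \<equiv> tree_msg (ln lam) A (\<lambda>v. spin_msg (\<omega> v)) (\<lambda>v. spin_msg (\<omega> v))"

text \<open>Only the spin \<open>\<omega> v\<close> survives in the sum, so the part below
  \<open>v\<close>, collected in \<open>c\<close>, cancels from the ratio and only the two edge
  weights \<beta> and 1 remain.\<close>

lemma edge_sum_pinned:
  assumes "\<And>s. node_weight d \<beta> (vertex_weight A \<omega>) k v s = (if s = \<omega> v then c s else 0)" "\<And>s. 0 < c s"
  shows "0 < edge_sum A \<omega> k v Plus \<and>
    edge_sum A \<omega> k v Minus = exp (spin_msg (\<omega> v)) * edge_sum A \<omega> k v Plus"
  using assms(2)[of Plus] assms(2)[of Minus] beta_pos unfolding edge_sum_def sum_spin assms(1)
  by (cases "\<omega> v") (auto simp: edge_weight_def spin_msg_def exp_bound)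

lemma node_weight_ratio:
  assumes "\<And>i. i < d \<Longrightarrow> 0 < edge_sum A \<omega> k (v @ [i]) Plus \<and>
      edge_sum A \<omega> k (v @ [i]) Minus = exp (spin_tree_msg A \<omega> k (v @ [i])) * edge_sum A \<omega> k (v @ [i]) Plus"
    and v: "v \<in> A"
  shows "0 < node_weight d \<beta> (vertex_weight A \<omega>) (Suc k) v Plus \<and>
    node_weight d \<beta> (vertex_weight A \<omega>) (Suc k) v Minus =
      exp (spin_field A \<omega> k v) * node_weight d \<beta> (vertex_weight A \<omega>) (Suc k) v Plus"
proof -
  have "(\<Prod>i<d. edge_sum A \<omega> k (v @ [i]) Minus) =
      (\<Prod>i<d. exp (spin_tree_msg A \<omega> k (v @ [i]))) * (\<Prod>i<d. edge_sum A \<omega> k (v @ [i]) Plus)"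
    using assms(1) by (simp add: prod.distrib[symmetric])
  moreover have "0 < (\<Prod>i<d. edge_sum A \<omega> k (v @ [i]) Plus)"
    using assms(1) by (intro prod_pos) auto
  ultimately show ?thesis
    using v lam_pos unfolding node_weight_Suc
    by (simp add: vertex_weight_def tree_field_def exp_add exp_sum)
qed

lemma edge_sum_ratio:
  assumes A: "\<And>v. v \<in> A \<Longrightarrow> length v < n"
  shows "length v + k = n \<Longrightarrow> 0 < edge_sum A \<omega> k v Plus \<and>
    edge_sum A \<omega> k v Minus = exp (spin_tree_msg A \<omega> k v) * edge_sum A \<omega> k v Plus"
proof (induction k arbitrary: v)
  case 0
  \<comment> \<open>At \<open>k = 0\<close> the vertex has depth exactly \<open>n\<close>, beyond
    \<open>A\<close>: the last level is always pinned, which is why \<open>x\<close> and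
    \<open>p\<close> are both given by \<open>\<omega>\<close>.\<close>
  then have "v \<notin> A" using A by fastforce
  then have "0 < edge_sum A \<omega> 0 v Plus \<and>
    edge_sum A \<omega> 0 v Minus = exp (spin_msg (\<omega> v)) * edge_sum A \<omega> 0 v Plus"
    by (intro edge_sum_pinned[of _ _ _ _ "\<lambda>_. 1"]) (auto simp: vertex_weight_def)
  then show ?case by simp
next
  case (Suc k)
  have IH: "0 < edge_sum A \<omega> k (v @ [i]) Plus \<and>
      edge_sum A \<omega> k (v @ [i]) Minus = exp (spin_tree_msg A \<omega> k (v @ [i])) * edge_sum A \<omega> k (v @ [i]) Plus" for i
    using Suc.prems by (intro Suc.IH) simp
  show ?case
  proof (cases "v \<in> A")
    case True
    define P where "P = node_weight d \<beta> (vertex_weight A \<omega>) (Suc k) v Plus"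
    define Y where "Y = spin_field A \<omega> k v"
    have P: "0 < P" "node_weight d \<beta> (vertex_weight A \<omega>) (Suc k) v Minus = exp Y * P"
      using node_weight_ratio[OF IH True] by (auto simp: P_def Y_def)
    have "edge_sum A \<omega> (Suc k) v Plus = (\<beta> + exp Y) * P" "edge_sum A \<omega> (Suc k) v Minus = (1 + \<beta> * exp Y) * P"
      unfolding edge_sum_def sum_spin P(2) P_def[symmetric]
      by (simp_all add: edge_weight_def algebra_simps)
    moreover have "0 < \<beta> + exp Y" "0 < 1 + \<beta> * exp Y" using beta_pos by (simp_all add: add_pos_pos)
    moreover have "exp (spin_tree_msg A \<omega> (Suc k) v) = (1 + \<beta> * exp Y) / (\<beta> + exp Y)"
      using True calculation(3,4) by (simp add: tree_msg_Suc msg_def Y_def del: tree_msg.simps)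
    ultimately show ?thesis using P(1) by simp
  next
    case False
    have c: "0 < (\<Prod>i<d. edge_sum A \<omega> k (v @ [i]) s)" for s
      using IH by (intro prod_pos) (cases s; auto)
    have "0 < edge_sum A \<omega> (Suc k) v Plus \<and>
      edge_sum A \<omega> (Suc k) v Minus = exp (spin_msg (\<omega> v)) * edge_sum A \<omega> (Suc k) v Plus"
      by (rule edge_sum_pinned[where c = "\<lambda>s. \<Prod>i<d. edge_sum A \<omega> k (v @ [i]) s", OF _ c]) (use False in \<open>simp add: node_weight_Suc vertex_weight_def del: node_weight.simps\<close>)
    then show ?thesis using False by simp
  qed
qed

text \<open>The vertex weights pin the spins outside \<open>A\<close> to \<open>\<omega>\<close>. The constant \<open>K\<close> collects the edges
  not touching \<open>A\<close>.\<close>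

lemma ball_sum_ising:
  assumes A: "A \<subseteq> {v \<in> tree_verts d. length v < n}"
  obtains K where "0 < K" "\<And>s. ball_sum d \<beta> (vertex_weight A \<omega>) n s =
    (\<Sum>\<tau>\<in>configs A. if override_on \<omega> \<tau> A [] = s
       then K * ising_weight (tree_edges d) \<beta> lam A (override_on \<omega> \<tau> A) else 0)"
proof
  let ?B = "tree_ball d n"
  let ?e = "\<lambda>\<omega> v. edge_weight \<beta> (\<omega> (butlast v)) (\<omega> v)"
  let ?U = "{v \<in> ?B - {[]}. v \<notin> A \<and> butlast v \<notin> A}"
  let ?W = "{v \<in> ?B - {[]}. v \<in> A \<or> butlast v \<in> A}"
  let ?K = "\<Prod>v\<in>?U. ?e \<omega> v"
  \<comment> \<open>The only configuration of the ball outside \<open>A\<close> with nonzero weight;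
    the outer sum collapses to it.\<close>
  define \<eta>0 where "\<eta>0 = restrict \<omega> (?B - A)"
  have AB: "A \<subseteq> ?B" using A by (auto simp: tree_ball_def)
  show "0 < ?K" using beta_pos by (intro prod_pos) (auto simp: edge_weight_def)
  fix s
  have disj: "(?B - A) \<inter> A = {}" and Un: "?B = (?B - A) \<union> A" using AB by auto
  have weight: "ball_weight d \<beta> (vertex_weight A \<omega>) n (override_on \<eta>0 \<tau> A) =
      ?K * ising_weight (tree_edges d) \<beta> lam A (override_on \<omega> \<tau> A)" for \<tau>
  proof -
    let ?\<omega>' = "override_on \<eta>0 \<tau> A" and ?\<omega>'' = "override_on \<omega> \<tau> A"
    have eq: "?\<omega>' v = ?\<omega>'' v" if "v \<in> ?B" for v
      using that by (auto simp: \<eta>0_def override_on_def)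
    have bl: "butlast v \<in> ?B" if "v \<in> ?B" for v
      using that butlast_in_tree_verts by (auto simp: tree_ball_def)
    have "(\<Prod>v\<in>?B. vertex_weight A \<omega> v (?\<omega>' v)) = (\<Prod>v\<in>A. if ?\<omega>'' v = Minus then lam else 1)"
      by (rule prod.mono_neutral_cong_right)
        (use AB in \<open>auto simp: vertex_weight_def \<eta>0_def override_on_def\<close>)
    moreover have "(\<Prod>v\<in>?B - {[]}. ?e ?\<omega>' v) = (\<Prod>v\<in>?W. ?e ?\<omega>'' v) * ?K"
    proof -
      have "(\<Prod>v\<in>?B - {[]}. ?e ?\<omega>' v) = (\<Prod>v\<in>?B - {[]}. ?e ?\<omega>'' v)"
        using eq bl by (intro prod.cong refl) (metis DiffD1)
      also have "\<dots> = (\<Prod>v\<in>?W \<union> ?U. ?e ?\<omega>'' v)" by (rule prod.cong) auto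
      also have "(\<Prod>v\<in>?W \<union> ?U. ?e ?\<omega>'' v) = (\<Prod>v\<in>?W. ?e ?\<omega>'' v) * (\<Prod>v\<in>?U. ?e ?\<omega>'' v)"
        by (rule prod.union_disjoint) auto
      also have "(\<Prod>v\<in>?U. ?e ?\<omega>'' v) = ?K" by (rule prod.cong) auto
      finally show ?thesis .
    qed
    ultimately show ?thesis
      unfolding ball_weight_def ising_weight_tree[OF A] by simp
  qed
  have zero: "ball_weight d \<beta> (vertex_weight A \<omega>) n (override_on \<eta> \<tau> A) = 0"
    if "\<eta> \<in> configs (?B - A)" "\<eta> \<noteq> \<eta>0" for \<eta> \<tau>
  proof -
    have "\<exists>v\<in>?B - A. \<eta> v \<noteq> \<eta>0 v"
      using that configs_eqI[of \<eta> "?B - A" \<eta>0] by (auto simp: \<eta>0_def)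
    then obtain v where "v \<in> ?B" "v \<notin> A" "\<eta> v \<noteq> \<omega> v" by (auto simp: \<eta>0_def)
    then have "vertex_weight A \<omega> v (override_on \<eta> \<tau> A v) = 0" by (simp add: vertex_weight_def)
    then have "(\<Prod>v\<in>?B. vertex_weight A \<omega> v (override_on \<eta> \<tau> A v)) = 0"
      using \<open>v \<in> ?B\<close> by (intro prod_zero) auto
    then show ?thesis by (simp add: ball_weight_def)
  qed
  have root: "override_on \<eta>0 \<tau> A [] = override_on \<omega> \<tau> A []" for \<tau>
    by (simp add: \<eta>0_def override_on_def)
  have "ball_sum d \<beta> (vertex_weight A \<omega>) n s = (\<Sum>\<eta>\<in>configs (?B - A). \<Sum>\<tau>\<in>configs A.
      if override_on \<eta> \<tau> A [] = s then ball_weight d \<beta> (vertex_weight A \<omega>) n (override_on \<eta> \<tau> A) else 0)"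
    unfolding ball_sum_def by (subst Un) (rule sum_configs_Un[OF disj])
  also have "\<dots> = (\<Sum>\<eta>\<in>{\<eta>0}. \<Sum>\<tau>\<in>configs A.
      if override_on \<eta> \<tau> A [] = s then ball_weight d \<beta> (vertex_weight A \<omega>) n (override_on \<eta> \<tau> A) else 0)"
    by (rule sum.mono_neutral_right)
      (auto simp: \<eta>0_def[symmetric] zero intro!: sum.neutral, auto simp: \<eta>0_def configs_def)
  finally show "ball_sum d \<beta> (vertex_weight A \<omega>) n s =
    (\<Sum>\<tau>\<in>configs A. if override_on \<omega> \<tau> A [] = s
       then ?K * ising_weight (tree_edges d) \<beta> lam A (override_on \<omega> \<tau> A) else 0)"
    by (simp add: weight root cong: if_cong)
qed

text \<open>The constant \<open>K\<close> cancels from the ratio of the two root sums. The ball has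
  radius \<open>Suc n\<close> because the spins next to \<open>A\<close> must belong to it, while
  the root field counts the \<open>n\<close> levels below the children of the root.\<close>

lemma root_marginal:
  assumes A: "A \<subseteq> {v \<in> tree_verts d. length v < Suc n}" and root: "[] \<in> A"
  shows "(\<Sum>\<tau>\<in>{\<tau> \<in> configs A. \<tau> [] = Plus}. ising_spec (tree_edges d) \<beta> lam A \<tau> \<omega>) =
    plus_prob (spin_field A \<omega> n [])"
proof -
  let ?w = "\<lambda>\<tau>. ising_weight (tree_edges d) \<beta> lam A (override_on \<omega> \<tau> A)"
  have finA: "finite A"
    by (rule finite_subset[OF A]) (rule finite_subset[OF _ finite_tree_ball[of d n]], auto simp: tree_ball_def)
  obtain K where K: "0 < K" and eq: "\<And>s. ball_sum d \<beta> (vertex_weight A \<omega>) (Suc n) s =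
    (\<Sum>\<tau>\<in>configs A. if override_on \<omega> \<tau> A [] = s then K * ?w \<tau> else 0)"
    using ball_sum_ising[OF A] by blast
  define Z where "Z s = (\<Sum>\<tau>\<in>{\<tau> \<in> configs A. \<tau> [] = s}. ?w \<tau>)" for s
  have Z: "node_weight d \<beta> (vertex_weight A \<omega>) (Suc n) [] s = K * Z s" for s
    unfolding ball_sum_eq_node_weight[symmetric] eq Z_def sum_distrib_left using root finA
    by (simp add: sum.inter_filter)
  have len: "length v < Suc n" if "v \<in> A" for v using A that by auto
  have ratio: "0 < edge_sum A \<omega> n ([] @ [i]) Plus \<and>
      edge_sum A \<omega> n ([] @ [i]) Minus = exp (spin_tree_msg A \<omega> n ([] @ [i])) * edge_sum A \<omega> n ([] @ [i]) Plus" for i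
    using edge_sum_ratio[of A "Suc n" "[] @ [i]" n, OF len] by simp
  have "0 < K * Z Plus" "K * Z Minus = exp (spin_field A \<omega> n []) * (K * Z Plus)"
    using node_weight_ratio[OF ratio root] unfolding Z by blast+
  then have Zr: "0 < Z Plus" "Z Minus = exp (spin_field A \<omega> n []) * Z Plus"
    using K by (auto simp: zero_less_mult_iff)
  have tot: "(\<Sum>\<tau>\<in>configs A. ?w \<tau>) = Z Plus + Z Minus"
  proof -
    have "configs A = {\<tau> \<in> configs A. \<tau> [] = Plus} \<union> {\<tau> \<in> configs A. \<tau> [] = Minus}"
      using spin.exhaust by auto
    then show ?thesis unfolding Z_def using finA
      by (subst sum.union_disjoint[symmetric]) auto
  qed
  have "(\<Sum>\<tau>\<in>{\<tau> \<in> configs A. \<tau> [] = Plus}. ising_spec (tree_edges d) \<beta> lam A \<tau> \<omega>) =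
      Z Plus / (Z Plus + Z Minus)"
    unfolding ising_spec_def tot Z_def sum_divide_distrib ..
  also have "\<dots> = plus_prob (spin_field A \<omega> n [])"
  proof -
    have "Z Plus + Z Minus = Z Plus * (1 + exp (spin_field A \<omega> n []))"
      by (simp add: Zr(2) algebra_simps)
    then show ?thesis using Zr(1) by (simp add: plus_prob_def)
  qed
  finally show ?thesis .
qed

end

section \<open>Gibbs measures\<close>

lemma space_config_space [simp]: "space (config_space V) = configs V"
  by (simp add: config_space_def configs_def space_PiM)

lemma measurable_spin: "v \<in> V \<Longrightarrow> (\<lambda>\<omega>. \<omega> v) \<in> measurable (config_space V) (count_space UNIV)"
  unfolding config_space_def by (rule measurable_component_singleton)

lemma space_outside_algebra [simp]: "space (outside_algebra V \<Lambda>) = configs V"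
  by (simp add: outside_algebra_def)

lemma subalgebra_outside_algebra:
  assumes "sets \<mu> = sets (config_space V)"
  shows "subalgebra \<mu> (outside_algebra V \<Lambda>)"
proof -
  have "space \<mu> = configs V" using sets_eq_imp_space_eq[OF assms] by simp
  moreover have "(\<lambda>\<omega>. restrict \<omega> (V - \<Lambda>)) \<in> measurable \<mu> (config_space (V - \<Lambda>))"
    unfolding measurable_cong_sets[OF assms refl] unfolding config_space_def
    by (rule measurable_restrict_subset) auto
  ultimately show ?thesis
    unfolding subalgebra_def outside_algebra_def by (auto dest: subsetD[OF sets_image_in_sets])
qed

lemma measurable_outside_spin:
  assumes "v \<in> V - \<Lambda>"
  shows "(\<lambda>\<omega>. \<omega> v) \<in> measurable (outside_algebra V \<Lambda>) (count_space UNIV)"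
proof -
  have "(\<lambda>\<omega>. restrict \<omega> (V - \<Lambda>) v) \<in> measurable (outside_algebra V \<Lambda>) (count_space UNIV)"
    unfolding outside_algebra_def
    by (rule measurable_compose[OF measurable_vimage_algebra1 measurable_spin[OF assms]])
      (intro funcsetI, simp only: space_config_space restrict_in_configs)
  then show ?thesis using assms by simp
qed

text \<open>Events of the outside algebra are preimages under restriction to the complement of
  \<Lambda>; in sums over the spins of \<Lambda> their indicator is therefore constant.\<close>

lemma outside_algebra_cong:
  assumes "B \<in> sets (outside_algebra V \<Lambda>)" "\<omega> \<in> configs V" "\<omega>' \<in> configs V"
    and "\<And>v. v \<in> V - \<Lambda> \<Longrightarrow> \<omega> v = \<omega>' v"
  shows "\<omega> \<in> B \<longleftrightarrow> \<omega>' \<in> B"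
proof -
  have "restrict \<omega> (V - \<Lambda>) = restrict \<omega>' (V - \<Lambda>)" using assms(4) by (auto simp: restrict_def)
  moreover obtain A where "B = (\<lambda>\<omega>. restrict \<omega> (V - \<Lambda>)) -` A \<inter> configs V"
    using assms(1) unfolding outside_algebra_def by (subst (asm) sets_vimage_algebra2) auto
  ultimately show ?thesis using assms(2,3) by simp
qed

lemma sets_cylinder:
  assumes "sets \<mu> = sets (config_space V)" "finite \<Lambda>" "\<Lambda> \<subseteq> V"
  shows "{\<omega> \<in> space \<mu>. \<forall>v\<in>\<Lambda>. \<omega> v = \<tau> v} \<in> sets \<mu>"
proof (rule sets.sets_Collect_finite_All)
  fix v assume "v \<in> \<Lambda>"
  then have "(\<lambda>\<omega>. \<omega> v) \<in> measurable \<mu> (count_space UNIV)"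
    using measurable_spin[of v V] assms by (auto simp: measurable_cong_sets[OF assms(1) refl])
  from measurable_sets[OF this, of "{\<tau> v}"]
  show "{\<omega> \<in> space \<mu>. \<omega> v = \<tau> v} \<in> sets \<mu>"
    by (simp add: vimage_def Int_def conj_commute)
qed (rule assms(2))

text \<open>The tower property over a finite region. \<open>F\<close> is a sum of conditional
  expectations, which brings integrability with it; the explicit formula then holds almost
  everywhere by the Gibbs property.\<close>

lemma ising_gibbs_prob_plus:
  assumes gibbs: "ising_gibbs V E \<beta> lam S \<sigma> \<mu>" and \<Lambda>: "finite \<Lambda>" "\<Lambda> \<subseteq> V - S" "v \<in> \<Lambda>"
  obtains F where "integrable \<mu> F" "prob_plus \<mu> v = (\<integral>\<omega>. F \<omega> \<partial>\<mu>)"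
    "AE \<omega> in \<mu>. (\<forall>u\<in>S. \<omega> u = \<sigma> u) \<and>
       F \<omega> = (\<Sum>\<tau>\<in>{\<tau> \<in> configs \<Lambda>. \<tau> v = Plus}. ising_spec E \<beta> lam \<Lambda> \<tau> \<omega>)"
proof
  let ?C = "\<lambda>\<tau>. {\<omega> \<in> space \<mu>. \<forall>u\<in>\<Lambda>. \<omega> u = \<tau> u}" and ?G = "outside_algebra V \<Lambda>"
  let ?P = "{\<tau> \<in> configs \<Lambda>. \<tau> v = Plus}"
  define F where "F \<omega> = (\<Sum>\<tau>\<in>?P. real_cond_exp \<mu> ?G (indicat_real (?C \<tau>)) \<omega>)" for \<omega>
  interpret prob_space \<mu> using gibbs by (simp add: ising_gibbs_def)
  have sets: "sets \<mu> = sets (config_space V)" using gibbs by (simp add: ising_gibbs_def)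
  interpret finite_measure_subalgebra \<mu> ?G
    by standard (rule subalgebra_outside_algebra[OF sets])
  have finP: "finite ?P" using \<Lambda> by simp
  have C: "?C \<tau> \<in> sets \<mu>" for \<tau> using sets_cylinder[OF sets] \<Lambda> by blast
  have int: "integrable \<mu> (indicat_real (?C \<tau>))" for \<tau>
    using C[of \<tau>] by (intro integrable_real_indicator) (auto simp: emeasure_eq_measure)
  show "integrable \<mu> F"
    unfolding F_def by (intro Bochner_Integration.integrable_sum real_cond_exp_int(1) int)
  \<comment> \<open>The cylinders are disjoint: only
    \<open>\<tau> = restrict \<omega> \<Lambda>\<close> contributes.\<close>
  have ind: "(\<Sum>\<tau>\<in>?P. indicat_real (?C \<tau>) \<omega>) = indicat_real {\<omega> \<in> space \<mu>. \<omega> v = Plus} \<omega>"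
    if \<omega>: "\<omega> \<in> space \<mu>" for \<omega>
  proof -
    have "(\<Sum>\<tau>\<in>?P. indicat_real (?C \<tau>) \<omega>) = (\<Sum>\<tau>\<in>?P. if \<tau> = restrict \<omega> \<Lambda> then 1 else 0)"
    proof (rule sum.cong)
      fix \<tau> assume "\<tau> \<in> ?P"
      then have "(\<forall>u\<in>\<Lambda>. \<omega> u = \<tau> u) \<longleftrightarrow> \<tau> = restrict \<omega> \<Lambda>"
        by (auto simp: configs_def PiE_def extensional_def fun_eq_iff restrict_def)
      then show "indicat_real (?C \<tau>) \<omega> = (if \<tau> = restrict \<omega> \<Lambda> then 1 else 0)"
        using \<omega> by (simp add: indicator_def)
    qed simp
    also have "\<dots> = indicat_real {\<omega> \<in> space \<mu>. \<omega> v = Plus} \<omega>"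
      using \<omega> finP \<Lambda>(3) by (simp add: indicator_def)
    finally show ?thesis .
  qed
  have "(\<integral>\<omega>. F \<omega> \<partial>\<mu>) = (\<Sum>\<tau>\<in>?P. \<integral>\<omega>. indicat_real (?C \<tau>) \<omega> \<partial>\<mu>)"
    unfolding F_def by (subst Bochner_Integration.integral_sum) (simp_all add: real_cond_exp_int int)
  also have "\<dots> = (\<integral>\<omega>. (\<Sum>\<tau>\<in>?P. indicat_real (?C \<tau>) \<omega>) \<partial>\<mu>)"
    by (rule Bochner_Integration.integral_sum[symmetric]) (rule int)
  also have "\<dots> = (\<integral>\<omega>. indicat_real {\<omega> \<in> space \<mu>. \<omega> v = Plus} \<omega> \<partial>\<mu>)"
    by (rule Bochner_Integration.integral_cong[OF refl ind])
  also have "\<dots> = prob_plus \<mu> v"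
  proof -
    have "{\<omega> \<in> space \<mu>. \<omega> v = Plus} \<inter> space \<mu> = {\<omega> \<in> space \<mu>. \<omega> v = Plus}" by auto
    then show ?thesis by (simp add: prob_plus_def)
  qed
  finally show "prob_plus \<mu> v = (\<integral>\<omega>. F \<omega> \<partial>\<mu>)" ..
  have "AE \<omega> in \<mu>. \<forall>\<tau>\<in>?P. real_cond_exp \<mu> ?G (indicat_real (?C \<tau>)) \<omega> = ising_spec E \<beta> lam \<Lambda> \<tau> \<omega>"
    using gibbs \<Lambda> by (intro AE_finite_allI finP) (simp add: ising_gibbs_def)
  moreover have "AE \<omega> in \<mu>. \<forall>u\<in>S. \<omega> u = \<sigma> u" using gibbs by (simp add: ising_gibbs_def)
  ultimately show "AE \<omega> in \<mu>. (\<forall>u\<in>S. \<omega> u = \<sigma> u) \<and>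
       F \<omega> = (\<Sum>\<tau>\<in>?P. ising_spec E \<beta> lam \<Lambda> \<tau> \<omega>)"
    by eventually_elim (simp add: F_def)
qed

text \<open>The bound holds for all pairs of values, so no coupling of the two measures is needed:
  average over the first with \<open>b\<close> fixed, then over the second.\<close>

lemma integral_diff_le:
  fixes F :: "'a \<Rightarrow> real" and G :: "'b \<Rightarrow> real"
  assumes "prob_space M" "prob_space N" "integrable M F" "integrable N G"
    and F: "AE x in M. F x \<in> A" and G: "AE x in N. G x \<in> B"
    and le: "\<And>a b. a \<in> A \<Longrightarrow> b \<in> B \<Longrightarrow> \<bar>a - b\<bar> \<le> c"
  shows "\<bar>(\<integral>x. F x \<partial>M) - (\<integral>x. G x \<partial>N)\<bar> \<le> c"
proof -
  interpret M: prob_space M by fact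
  interpret N: prob_space N by fact
  have F_le: "\<bar>(\<integral>x. F x \<partial>M) - b\<bar> \<le> c" if "b \<in> B" for b
  proof -
    have "AE x in M. F x \<le> b + c" "AE x in M. b - c \<le> F x"
      using F by (eventually_elim, use le[OF _ that] in fastforce)+
    then have "(\<integral>x. F x \<partial>M) \<le> b + c" "b - c \<le> (\<integral>x. F x \<partial>M)"
      using assms(3) by (auto intro: M.integral_le_const M.integral_ge_const)
    then show ?thesis by linarith
  qed
  have "AE x in N. G x \<le> (\<integral>x. F x \<partial>M) + c" "AE x in N. (\<integral>x. F x \<partial>M) - c \<le> G x"
    using G by (eventually_elim, use F_le in fastforce)+
  then have "(\<integral>x. G x \<partial>N) \<le> (\<integral>x. F x \<partial>M) + c" "(\<integral>x. F x \<partial>M) - c \<le> (\<integral>x. G x \<partial>N)"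
    using assms(4) by (auto intro: N.integral_le_const N.integral_ge_const)
  then show ?thesis by linarith
qed

section \<open>Existence of a Gibbs measure when all but finitely many spins are pinned\<close>

lemma ising_weight_prod:
  assumes "finite \<Lambda>" "finite {e \<in> E. e \<inter> \<Lambda> \<noteq> {}}"
  shows "ising_weight E \<beta> lam \<Lambda> \<omega> = (\<Prod>v\<in>\<Lambda>. if \<omega> v = Minus then lam else 1) *
    (\<Prod>e\<in>{e \<in> E. e \<inter> \<Lambda> \<noteq> {}}. if \<forall>u\<in>e. \<forall>v\<in>e. \<omega> u = \<omega> v then \<beta> else 1)"
  unfolding ising_weight_def num_minus_def num_equal_edges_def using assms
  by (simp add: prod.If_cases Int_def conj_assoc)

lemma ising_weight_pos: "0 < \<beta> \<Longrightarrow> 0 < lam \<Longrightarrow> 0 < ising_weight E \<beta> lam \<Lambda> \<omega>"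
  by (simp add: ising_weight_def)

lemma borel_measurable_ising_weight:
  assumes "finite \<Lambda>" "finite {e \<in> E. e \<inter> \<Lambda> \<noteq> {}}"
    and E: "\<And>e. e \<in> E \<Longrightarrow> finite e \<and> e \<subseteq> V" and "\<Lambda> \<subseteq> V"
    and T: "\<And>v. v \<in> V \<Longrightarrow> (\<lambda>\<omega>. T \<omega> v) \<in> measurable M (count_space UNIV)"
  shows "(\<lambda>\<omega>. ising_weight E \<beta> lam \<Lambda> (T \<omega>)) \<in> borel_measurable M"
proof -
  have minus: "Measurable.pred M (\<lambda>\<omega>. T \<omega> v = Minus)" if "v \<in> V" for v
    using T[OF that] by (rule pred_eq_const1) simp
  \<comment> \<open>Expresses equality of two spins by events at single vertices, so that
    measurability follows from closure under logical connectives.\<close>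
  have eq: "s = s' \<longleftrightarrow> (s = Minus \<longleftrightarrow> s' = Minus)" for s s' :: spin
    by (cases s; cases s') auto
  have "Measurable.pred M (\<lambda>\<omega>. T \<omega> v = Minus)" if "v \<in> \<Lambda>" for v
    using minus assms(4) that by blast
  moreover have "Measurable.pred M (\<lambda>\<omega>. \<forall>u\<in>e. \<forall>v\<in>e. T \<omega> u = T \<omega> v)" if "e \<in> E" for e
    using E[OF that] by (subst eq) (intro pred_intros_finite pred_intros_logic minus; auto)
  ultimately show ?thesis
    unfolding ising_weight_prod[OF assms(1,2)]
    by (intro borel_measurable_times borel_measurable_prod measurable_If) auto
qed

text \<open>\<open>R\<close> collects the vertices outside \<Lambda> and the edges not touching
  \<Lambda>. It cancels from conditional probabilities on \<Lambda>, which is the consistency of the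
  specification.\<close>

lemma ising_weight_split:
  assumes "finite \<Lambda>\<^sub>0" "finite {e \<in> E. e \<inter> \<Lambda>\<^sub>0 \<noteq> {}}" "\<Lambda> \<subseteq> \<Lambda>\<^sub>0"
  obtains R where "\<And>\<omega>. ising_weight E \<beta> lam \<Lambda>\<^sub>0 \<omega> = R \<omega> * ising_weight E \<beta> lam \<Lambda> \<omega>"
    "\<And>\<omega> \<omega>'. (\<And>v. v \<notin> \<Lambda> \<Longrightarrow> \<omega> v = \<omega>' v) \<Longrightarrow> R \<omega> = R \<omega>'"
proof
  let ?E = "\<lambda>\<Lambda>. {e \<in> E. e \<inter> \<Lambda> \<noteq> {}}"
  let ?f = "\<lambda>\<omega> v. if \<omega> v = Minus then lam else 1"
  let ?g = "\<lambda>\<omega> e. if \<forall>u\<in>e. \<forall>v\<in>e. \<omega> u = \<omega> v then \<beta> else 1"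
  define R where "R \<omega> = (\<Prod>v\<in>\<Lambda>\<^sub>0 - \<Lambda>. ?f \<omega> v) * (\<Prod>e\<in>?E \<Lambda>\<^sub>0 - ?E \<Lambda>. ?g \<omega> e)" for \<omega>
  have sub: "?E \<Lambda> \<subseteq> ?E \<Lambda>\<^sub>0" using assms(3) by auto
  have fin: "finite \<Lambda>" "finite (?E \<Lambda>)"
    using assms(1,3) finite_subset apply blast
    using sub assms(2) finite_subset by blast
  show "ising_weight E \<beta> lam \<Lambda>\<^sub>0 \<omega> = R \<omega> * ising_weight E \<beta> lam \<Lambda> \<omega>" for \<omega>
    unfolding ising_weight_prod[OF assms(1,2)] ising_weight_prod[OF fin] R_def
      prod.subset_diff[OF assms(3,1)] prod.subset_diff[OF sub assms(2)]
    by simp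
  show "R \<omega> = R \<omega>'" if eq: "\<And>v. v \<notin> \<Lambda> \<Longrightarrow> \<omega> v = \<omega>' v" for \<omega> \<omega>'
  proof -
    have "?g \<omega> e = ?g \<omega>' e" if "e \<in> ?E \<Lambda>\<^sub>0 - ?E \<Lambda>" for e
    proof -
      have "\<omega> v = \<omega>' v" if "v \<in> e" for v using eq[of v] that \<open>e \<in> ?E \<Lambda>\<^sub>0 - ?E \<Lambda>\<close> by auto
      then show ?thesis by simp
    qed
    then have "(\<Prod>e\<in>?E \<Lambda>\<^sub>0 - ?E \<Lambda>. ?g \<omega> e) = (\<Prod>e\<in>?E \<Lambda>\<^sub>0 - ?E \<Lambda>. ?g \<omega>' e)" by (intro prod.cong refl)
    moreover have "(\<Prod>v\<in>\<Lambda>\<^sub>0 - \<Lambda>. ?f \<omega> v) = (\<Prod>v\<in>\<Lambda>\<^sub>0 - \<Lambda>. ?f \<omega>' v)"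
      using eq by (intro prod.cong) auto
    ultimately show ?thesis by (simp add: R_def)
  qed
qed

text \<open>The measure is the finite Gibbs distribution on \<open>\<Lambda>\<^sub>0\<close>, pushed
  forward by filling in \<sigma> elsewhere. All integrals become finite sums, and the conditional
  probabilities are checked on each outside event.\<close>

lemma ising_gibbs_exists_cofinite:
  assumes V: "countable V" and \<Lambda>\<^sub>0: "finite \<Lambda>\<^sub>0" "\<Lambda>\<^sub>0 \<subseteq> V"
    and E: "\<And>e. e \<in> E \<Longrightarrow> finite e \<and> e \<subseteq> V" and finE: "finite {e \<in> E. e \<inter> \<Lambda>\<^sub>0 \<noteq> {}}"
    and pos: "0 < \<beta>" "0 < lam"
  shows "\<exists>\<mu>. ising_gibbs V E \<beta> lam (V - \<Lambda>\<^sub>0) \<sigma> \<mu>"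
proof -
  define ext where "ext \<tau> = restrict (override_on \<sigma> \<tau> \<Lambda>\<^sub>0) V" for \<tau>
  define w where "w \<tau> = ising_weight E \<beta> lam \<Lambda>\<^sub>0 (ext \<tau>)" for \<tau>
  define Z where "Z = (\<Sum>\<tau>\<in>configs \<Lambda>\<^sub>0. w \<tau>)"
  define M where "M = point_measure (configs \<Lambda>\<^sub>0) (\<lambda>\<tau>. ennreal (w \<tau> / Z))"
  define \<mu> where "\<mu> = distr M (config_space V) ext"
  have w_pos: "0 < w \<tau>" for \<tau> unfolding w_def by (rule ising_weight_pos[OF pos])
  have ne: "configs \<Lambda> \<noteq> {}" for \<Lambda> :: "'a set" by (auto simp: configs_def PiE_eq_empty_iff)
  have fin0: "finite (configs \<Lambda>\<^sub>0)" using \<Lambda>\<^sub>0 by simp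
  have Z_pos: "0 < Z" unfolding Z_def using fin0 ne w_pos by (intro sum_pos) auto
  have ext_in: "ext \<tau> \<in> configs V" for \<tau> by (simp add: ext_def)
  have ext_meas: "ext \<in> measurable M (config_space V)"
    unfolding M_def by (subst measurable_point_measure_eq1) (auto simp: ext_in)
  have "emeasure M (space M) = (\<Sum>\<tau>\<in>configs \<Lambda>\<^sub>0. ennreal (w \<tau> / Z))"
    unfolding M_def space_point_measure by (rule emeasure_point_measure_finite) (use fin0 in auto)
  also have "\<dots> = ennreal (\<Sum>\<tau>\<in>configs \<Lambda>\<^sub>0. w \<tau> / Z)"
    using w_pos Z_pos by (intro sum_ennreal) (simp add: less_imp_le)
  also have "(\<Sum>\<tau>\<in>configs \<Lambda>\<^sub>0. w \<tau> / Z) = 1"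
    using Z_pos by (simp add: sum_divide_distrib[symmetric] Z_def[symmetric])
  finally have M: "prob_space M" by (intro prob_spaceI) simp
  have prob: "prob_space \<mu>" unfolding \<mu>_def by (rule prob_space.prob_space_distr[OF M ext_meas])
  have sets: "sets \<mu> = sets (config_space V)" by (simp add: \<mu>_def)
  have space: "space \<mu> = configs V" by (simp add: \<mu>_def)
  interpret prob_space \<mu> by fact
  have integral: "(\<integral>\<omega>. f \<omega> \<partial>\<mu>) = (\<Sum>\<tau>\<in>configs \<Lambda>\<^sub>0. w \<tau> / Z * f (ext \<tau>))"
    if "f \<in> borel_measurable (config_space V)" for f :: "_ \<Rightarrow> real"
    unfolding \<mu>_def integral_distr[OF ext_meas that] unfolding M_def
    using w_pos Z_pos
    by (subst lebesgue_integral_point_measure_finite[OF fin0]) (auto simp: less_imp_le)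
  have AE_S: "AE \<omega> in \<mu>. \<forall>v\<in>V - \<Lambda>\<^sub>0. \<omega> v = \<sigma> v"
  proof (subst AE_ball_countable)
    show "countable (V - \<Lambda>\<^sub>0)" using V by simp
    show "\<forall>v\<in>V - \<Lambda>\<^sub>0. AE \<omega> in \<mu>. \<omega> v = \<sigma> v"
    proof
      fix v assume v: "v \<in> V - \<Lambda>\<^sub>0"
      have "{\<omega> \<in> space (config_space V). \<forall>u\<in>{v}. \<omega> u = \<sigma> u} \<in> sets (config_space V)"
        using v by (intro sets_cylinder) auto
      then show "AE \<omega> in \<mu>. \<omega> v = \<sigma> v"
        unfolding \<mu>_def using v by (subst AE_distr_iff[OF ext_meas]) (auto simp: ext_def)
    qed
  qed
  have cond: "AE \<omega> in \<mu>. real_cond_exp \<mu> (outside_algebra V \<Lambda>)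
             (indicat_real {\<omega>' \<in> space \<mu>. \<forall>v\<in>\<Lambda>. \<omega>' v = \<tau> v}) \<omega>
           = ising_spec E \<beta> lam \<Lambda> \<tau> \<omega>"
    if \<Lambda>: "finite \<Lambda>" "\<Lambda> \<subseteq> \<Lambda>\<^sub>0" and \<tau>: "\<tau> \<in> configs \<Lambda>" for \<Lambda> \<tau>
  proof -
    let ?C = "{\<omega>' \<in> space \<mu>. \<forall>v\<in>\<Lambda>. \<omega>' v = \<tau> v}"
    have finE': "finite {e \<in> E. e \<inter> \<Lambda> \<noteq> {}}" by (rule finite_subset[OF _ finE]) (use \<Lambda> in auto)
    have \<Lambda>V: "\<Lambda> \<subseteq> V" using \<Lambda> \<Lambda>\<^sub>0 by blast
    interpret finite_measure_subalgebra \<mu> "outside_algebra V \<Lambda>"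
      by standard (rule subalgebra_outside_algebra[OF sets])
    have C: "?C \<in> sets \<mu>" by (rule sets_cylinder[OF sets \<Lambda>(1) \<Lambda>V])
    have spec_meas: "(\<lambda>\<omega>. ising_spec E \<beta> lam \<Lambda> \<tau> \<omega>) \<in> borel_measurable (outside_algebra V \<Lambda>)"
    proof -
      have "(\<lambda>\<omega>. ising_weight E \<beta> lam \<Lambda> (override_on \<omega> \<tau>' \<Lambda>)) \<in> borel_measurable (outside_algebra V \<Lambda>)" for \<tau>'
      proof (rule borel_measurable_ising_weight[OF \<Lambda>(1) finE' E \<Lambda>V])
        fix v assume "v \<in> V"
        then show "(\<lambda>\<omega>. override_on \<omega> \<tau>' \<Lambda> v) \<in> measurable (outside_algebra V \<Lambda>) (count_space UNIV)"
          using measurable_outside_spin[of v V \<Lambda>] by (cases "v \<in> \<Lambda>") auto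
      qed
      then show ?thesis unfolding ising_spec_def by (intro borel_measurable_divide borel_measurable_sum)
    qed
    then have spec_meas': "(\<lambda>\<omega>. ising_spec E \<beta> lam \<Lambda> \<tau> \<omega>) \<in> borel_measurable (config_space V)"
      using measurable_from_subalg[OF subalgebra_outside_algebra[OF refl]] by blast
    have spec_bound: "\<bar>ising_spec E \<beta> lam \<Lambda> \<tau> \<omega>\<bar> \<le> 1" for \<omega>
    proof -
      have "ising_weight E \<beta> lam \<Lambda> (override_on \<omega> \<tau> \<Lambda>) \<le>
          (\<Sum>\<tau>'\<in>configs \<Lambda>. ising_weight E \<beta> lam \<Lambda> (override_on \<omega> \<tau>' \<Lambda>))"
        using \<tau> \<Lambda>(1) by (intro member_le_sum) (auto intro: less_imp_le ising_weight_pos[OF pos])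
      moreover have "0 < ising_weight E \<beta> lam \<Lambda> (override_on \<omega> \<tau> \<Lambda>)" by (rule ising_weight_pos[OF pos])
      ultimately show ?thesis unfolding ising_spec_def by (simp add: divide_le_eq)
    qed
    show ?thesis
    proof (rule real_cond_exp_charact)
      show "integrable \<mu> (indicat_real ?C)"
        using C by (intro integrable_real_indicator) (auto simp: emeasure_eq_measure)
      show "integrable \<mu> (ising_spec E \<beta> lam \<Lambda> \<tau>)"
        using spec_bound spec_meas' by (intro integrable_const_bound[of _ 1]) (auto simp: measurable_cong_sets[OF sets refl])
      fix B assume B: "B \<in> sets (outside_algebra V \<Lambda>)"
      then have B': "B \<in> sets (config_space V)"
        using subalgebra_outside_algebra[OF refl] by (auto simp: subalgebra_def)
      let ?\<Delta> = "\<Lambda>\<^sub>0 - \<Lambda>"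
      have split: "configs \<Lambda>\<^sub>0 = configs (?\<Delta> \<union> \<Lambda>)" using \<Lambda> by (simp add: Un_absorb2)
      obtain R where R: "\<And>\<omega>. ising_weight E \<beta> lam \<Lambda>\<^sub>0 \<omega> = R \<omega> * ising_weight E \<beta> lam \<Lambda> \<omega>"
        and R_cong: "\<And>\<omega> \<omega>'. (\<And>v. v \<notin> \<Lambda> \<Longrightarrow> \<omega> v = \<omega>' v) \<Longrightarrow> R \<omega> = R \<omega>'"
        using ising_weight_split[OF \<Lambda>\<^sub>0(1) finE \<Lambda>(2)] by blast
      \<comment> \<open>A configuration is coded by its part \<eta> outside \<Lambda> and its part
        \<open>\<tau>'\<close> inside. Quantities that ignore the inside, such as \<open>R\<close>
        and the indicator of \<open>B\<close>, are evaluated at the reference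
        \<open>\<omega> \<eta> \<tau>\<close>.\<close>
      define \<omega> where "\<omega> \<eta> \<tau>' = ext (override_on \<eta> \<tau>' \<Lambda>)" for \<eta> \<tau>'
      define W where "W \<eta> \<tau>' = ising_weight E \<beta> lam \<Lambda> (\<omega> \<eta> \<tau>')" for \<eta> \<tau>'
      have W_pos: "0 < W \<eta> \<tau>'" for \<eta> \<tau>' unfolding W_def by (rule ising_weight_pos[OF pos])
      have agree: "\<omega> \<eta> \<tau>1 v = \<omega> \<eta> \<tau>2 v" if "v \<notin> \<Lambda>" for \<eta> \<tau>1 \<tau>2 v
        using that by (simp add: \<omega>_def ext_def override_on_def)
      have w: "w (override_on \<eta> \<tau>' \<Lambda>) = R (\<omega> \<eta> \<tau>) * W \<eta> \<tau>'" for \<eta> \<tau>'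
        unfolding w_def \<omega>_def[symmetric] R W_def using R_cong[of "\<omega> \<eta> \<tau>'" "\<omega> \<eta> \<tau>"] agree by simp
      have integral': "(\<integral>\<omega>. f \<omega> \<partial>\<mu>) = (\<Sum>\<eta>\<in>configs ?\<Delta>. \<Sum>\<tau>'\<in>configs \<Lambda>.
          R (\<omega> \<eta> \<tau>) * W \<eta> \<tau>' / Z * f (\<omega> \<eta> \<tau>'))"
        if "f \<in> borel_measurable (config_space V)" for f :: "_ \<Rightarrow> real"
      proof -
        have "(\<integral>\<omega>. f \<omega> \<partial>\<mu>) = (\<Sum>\<eta>\<in>configs ?\<Delta>. \<Sum>\<tau>'\<in>configs \<Lambda>.
            w (override_on \<eta> \<tau>' \<Lambda>) / Z * f (ext (override_on \<eta> \<tau>' \<Lambda>)))"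
          unfolding integral[OF that] split by (rule sum_configs_Un) auto
        then show ?thesis unfolding w \<omega>_def[symmetric] .
      qed
      have in_B: "\<omega> \<eta> \<tau>' \<in> B \<longleftrightarrow> \<omega> \<eta> \<tau> \<in> B" for \<eta> \<tau>'
        by (rule outside_algebra_cong[OF B]) (simp_all add: \<omega>_def ext_in, simp add: \<omega>_def[symmetric] agree)
      have over: "override_on (\<omega> \<eta> \<tau>1) \<tau>2 \<Lambda> = \<omega> \<eta> \<tau>2" for \<eta> \<tau>1 \<tau>2
        using \<Lambda>(2) \<Lambda>V by (auto simp: \<omega>_def ext_def override_on_def fun_eq_iff restrict_def)
      have spec: "ising_spec E \<beta> lam \<Lambda> \<tau> (\<omega> \<eta> \<tau>') = W \<eta> \<tau> / (\<Sum>\<tau>''\<in>configs \<Lambda>. W \<eta> \<tau>'')" for \<eta> \<tau>'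
        by (simp add: ising_spec_def over W_def)
      have in_C: "\<omega> \<eta> \<tau>' \<in> ?C \<longleftrightarrow> \<tau>' = \<tau>" if "\<tau>' \<in> configs \<Lambda>" for \<eta> \<tau>'
      proof -
        have "\<omega> \<eta> \<tau>' v = \<tau>' v" if "v \<in> \<Lambda>" for v
          using that \<Lambda>(2) \<Lambda>V by (auto simp: \<omega>_def ext_def)
        then have "\<omega> \<eta> \<tau>' \<in> ?C \<longleftrightarrow> (\<forall>v\<in>\<Lambda>. \<tau>' v = \<tau> v)"
          by (simp add: space \<omega>_def ext_in)
        also have "\<dots> \<longleftrightarrow> \<tau>' = \<tau>"
          using that \<tau> configs_eqI[of \<tau>' \<Lambda> \<tau>] by blast
        finally show ?thesis .
      qed
      have "set_lebesgue_integral \<mu> B (indicat_real ?C) =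
          (\<Sum>\<eta>\<in>configs ?\<Delta>. \<Sum>\<tau>'\<in>configs \<Lambda>. R (\<omega> \<eta> \<tau>) * W \<eta> \<tau>' / Z *
            (indicat_real B (\<omega> \<eta> \<tau>') * indicat_real ?C (\<omega> \<eta> \<tau>')))"
        unfolding set_lebesgue_integral_def using B' C sets by (subst integral') auto
      also have "\<dots> = (\<Sum>\<eta>\<in>configs ?\<Delta>. \<Sum>\<tau>'\<in>configs \<Lambda>. if \<tau>' = \<tau> then
            R (\<omega> \<eta> \<tau>) * W \<eta> \<tau> / Z * indicat_real B (\<omega> \<eta> \<tau>) else 0)"
        using in_C by (intro sum.cong refl) (auto simp: indicator_def)
      also have "\<dots> = (\<Sum>\<eta>\<in>configs ?\<Delta>. R (\<omega> \<eta> \<tau>) * W \<eta> \<tau> / Z * indicat_real B (\<omega> \<eta> \<tau>))"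
        using \<Lambda>(1) \<tau> by simp
      \<comment> \<open>Spreads the weight of \<tau> over all inside configurations:
        \<open>W \<eta> \<tau>\<close> is the sum of all \<open>W \<eta> \<tau>'\<close> times the
        conditional probability of \<tau>.\<close>
      also have "\<dots> = (\<Sum>\<eta>\<in>configs ?\<Delta>. \<Sum>\<tau>'\<in>configs \<Lambda>. R (\<omega> \<eta> \<tau>) * W \<eta> \<tau>' / Z *
            (indicat_real B (\<omega> \<eta> \<tau>) * (W \<eta> \<tau> / (\<Sum>\<tau>''\<in>configs \<Lambda>. W \<eta> \<tau>''))))"
      proof (rule sum.cong[OF refl])
        fix \<eta>
        have "0 < (\<Sum>\<tau>''\<in>configs \<Lambda>. W \<eta> \<tau>'')" using \<Lambda>(1) ne W_pos by (intro sum_pos) auto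
        then show "R (\<omega> \<eta> \<tau>) * W \<eta> \<tau> / Z * indicat_real B (\<omega> \<eta> \<tau>) =
          (\<Sum>\<tau>'\<in>configs \<Lambda>. R (\<omega> \<eta> \<tau>) * W \<eta> \<tau>' / Z *
            (indicat_real B (\<omega> \<eta> \<tau>) * (W \<eta> \<tau> / (\<Sum>\<tau>''\<in>configs \<Lambda>. W \<eta> \<tau>''))))"
          unfolding sum_distrib_right[symmetric] sum_divide_distrib[symmetric] sum_distrib_left[symmetric]
          by simp
      qed
      also have "\<dots> = set_lebesgue_integral \<mu> B (ising_spec E \<beta> lam \<Lambda> \<tau>)"
      proof -
        have ind: "indicat_real B (\<omega> \<eta> \<tau>') = indicat_real B (\<omega> \<eta> \<tau>)" for \<eta> \<tau>'
          using in_B[of \<eta> \<tau>'] by (auto simp: indicator_def)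
        have "set_lebesgue_integral \<mu> B (ising_spec E \<beta> lam \<Lambda> \<tau>) =
          (\<Sum>\<eta>\<in>configs ?\<Delta>. \<Sum>\<tau>'\<in>configs \<Lambda>. R (\<omega> \<eta> \<tau>) * W \<eta> \<tau>' / Z *
            (indicat_real B (\<omega> \<eta> \<tau>') * ising_spec E \<beta> lam \<Lambda> \<tau> (\<omega> \<eta> \<tau>')))"
          unfolding set_lebesgue_integral_def using B' spec_meas' by (subst integral') auto
        also have "\<dots> = (\<Sum>\<eta>\<in>configs ?\<Delta>. \<Sum>\<tau>'\<in>configs \<Lambda>. R (\<omega> \<eta> \<tau>) * W \<eta> \<tau>' / Z *
            (indicat_real B (\<omega> \<eta> \<tau>) * (W \<eta> \<tau> / (\<Sum>\<tau>''\<in>configs \<Lambda>. W \<eta> \<tau>''))))"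
          unfolding spec by (intro sum.cong refl arg_cong2[where f = "(*)"] ind)
        finally show ?thesis ..
      qed
      finally show "set_lebesgue_integral \<mu> B (indicat_real ?C) =
        set_lebesgue_integral \<mu> B (ising_spec E \<beta> lam \<Lambda> \<tau>)" .
    qed (rule spec_meas)
  qed
  have "ising_gibbs V E \<beta> lam (V - \<Lambda>\<^sub>0) \<sigma> \<mu>"
    unfolding ising_gibbs_def
  proof (intro conjI allI impI ballI)
    fix \<Lambda> \<tau> assume *: "finite \<Lambda> \<and> \<Lambda> \<subseteq> V - (V - \<Lambda>\<^sub>0)" "\<tau> \<in> configs \<Lambda>"
    then have "finite \<Lambda>" "\<Lambda> \<subseteq> \<Lambda>\<^sub>0" by auto
    then show "AE \<omega> in \<mu>. real_cond_exp \<mu> (outside_algebra V \<Lambda>)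
        (indicat_real {\<omega>' \<in> space \<mu>. \<forall>v\<in>\<Lambda>. \<omega>' v = \<tau> v}) \<omega> = ising_spec E \<beta> lam \<Lambda> \<tau> \<omega>"
      using cond *(2) by blast
  qed (fact prob sets AE_S)+
  then show ?thesis ..
qed

section \<open>Spatial mixing on the tree\<close>

lemma tree_path_length: "([], v) \<in> adj (tree_edges d) ^^ m \<Longrightarrow> length v \<le> m"
proof (induction m arbitrary: v)
  case (Suc m)
  then obtain u where u: "([], u) \<in> adj (tree_edges d) ^^ m" "(u, v) \<in> adj (tree_edges d)" by auto
  from u(2) obtain x i where "{u, v} = {x, x @ [i]}" by (auto simp: adj_def tree_edges_def)
  then have "length v \<le> Suc (length u)" by (auto simp: doubleton_eq_iff)
  then show ?case using Suc.IH[OF u(1)] by simp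
qed simp

lemma tree_path_exists: "v \<in> tree_verts d \<Longrightarrow> ([], v) \<in> adj (tree_edges d) ^^ length v"
proof (induction v rule: rev_induct)
  case (snoc i v)
  then have v: "v \<in> tree_verts d" "i < d" by (auto simp: tree_verts_def)
  then have "(v, v @ [i]) \<in> adj (tree_edges d)" by (auto simp: adj_def tree_edges_def)
  then show ?case using snoc.IH[OF v(1)] by auto
qed simp

lemma graph_dist_tree: "v \<in> tree_verts d \<Longrightarrow> graph_dist (tree_edges d) [] v = length v"
  unfolding graph_dist_def using tree_path_exists tree_path_length by (intro Least_equality) auto

lemma set_graph_dist_tree_le:
  assumes "T \<subseteq> tree_verts d" "v \<in> T"
  shows "set_graph_dist (tree_edges d) [] T \<le> length v"
proof -
  have "set_graph_dist (tree_edges d) [] T \<le> graph_dist (tree_edges d) [] v"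
    unfolding set_graph_dist_def using assms(2) by (intro cINF_lower) auto
  then show ?thesis using assms by (auto simp: graph_dist_tree subset_iff)
qed

lemma set_graph_dist_tree_ge:
  assumes "S \<subseteq> tree_verts d" "S \<noteq> {}" "\<And>v. v \<in> S \<Longrightarrow> n \<le> length v"
  shows "n \<le> set_graph_dist (tree_edges d) [] S"
  unfolding set_graph_dist_def using assms
  by (intro cINF_greatest) (auto simp: graph_dist_tree subset_iff)

lemma tree_gibbs_exists_outside_ball:
  assumes "0 < \<beta>" "0 < lam"
  shows "\<exists>\<mu>. tree_gibbs d \<beta> lam (tree_verts d - {v \<in> tree_verts d. length v < n}) \<sigma> \<mu>"
proof (rule ising_gibbs_exists_cofinite)
  let ?A = "{v \<in> tree_verts d. length v < n}"
  show "finite ?A"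
    by (rule finite_subset[OF _ finite_tree_ball[of d n]]) (auto simp: tree_ball_def)
  show "finite e \<and> e \<subseteq> tree_verts d" if "e \<in> tree_edges d" for e
    using that by (auto simp: tree_edges_def tree_verts_def)
  have "{e \<in> tree_edges d. e \<inter> ?A \<noteq> {}} \<subseteq> Pow (tree_ball d n)"
    by (auto simp: tree_edges_def tree_ball_def tree_verts_def)
  then show "finite {e \<in> tree_edges d. e \<inter> ?A \<noteq> {}}"
    by (rule finite_subset) simp
qed (use assms in \<open>auto intro: countableI_type\<close>)

lemma prob_plus_bounds: "prob_space \<mu> \<Longrightarrow> 0 \<le> prob_plus \<mu> v \<and> prob_plus \<mu> v \<le> 1"
  by (simp add: prob_plus_def prob_space.prob_le_1)

section \<open>Weak mixing, the derivative at the fixed point, and strong mixing\<close>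

context antiferro_tree
begin

text \<open>By symmetry all vertices of one depth have the same field. Depth \<open>k\<close> sees
  \<open>d\<close> pinned children, which gives the starting value, and \<open>k\<close> further
  steps lead to the root.\<close>

lemma prob_plus_outside_ball:
  assumes gibbs: "tree_gibbs d \<beta> lam (tree_verts d - {v \<in> tree_verts d. length v < Suc k}) \<sigma> \<mu>"
    and \<sigma>: "\<And>v. v \<in> tree_verts d \<Longrightarrow> length v \<ge> Suc k \<Longrightarrow> \<sigma> v = s"
  shows "prob_plus \<mu> [] = plus_prob ((step (ln lam) ^^ k) (ln lam + d * spin_msg s))"
proof -
  let ?A = "{v \<in> tree_verts d. length v < Suc k}"
  have finA: "finite ?A"
    by (rule finite_subset[OF _ finite_tree_ball[of d k]]) (auto simp: tree_ball_def)
  have root: "[] \<in> ?A" by (simp add: tree_verts_def)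
  obtain F where F: "integrable \<mu> F" "prob_plus \<mu> [] = (\<integral>\<omega>. F \<omega> \<partial>\<mu>)"
    "AE \<omega> in \<mu>. (\<forall>u\<in>tree_verts d - ?A. \<omega> u = \<sigma> u) \<and>
       F \<omega> = (\<Sum>\<tau>\<in>{\<tau> \<in> configs ?A. \<tau> [] = Plus}. ising_spec (tree_edges d) \<beta> lam ?A \<tau> \<omega>)"
    using ising_gibbs_prob_plus[OF gibbs finA _ root] by blast
  let ?y = "\<lambda>j. (step (ln lam) ^^ j) (ln lam + d * spin_msg s)"
  have field: "spin_field ?A \<omega> k [] = ?y k" if \<omega>: "\<forall>u\<in>tree_verts d - ?A. \<omega> u = \<sigma> u" for \<omega>
  proof -
    have "spin_field ?A \<omega> j v = ?y j" if "v \<in> tree_verts d" "length v + j = k" for j v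
      using that
    proof (induction j arbitrary: v)
      case 0
      have "\<omega> (v @ [i]) = s" if "i < d" for i
        using 0 that \<omega> \<sigma>[of "v @ [i]"] by (auto simp: tree_verts_def)
      then show ?case by (simp add: tree_field_def)
    next
      case (Suc j)
      have "spin_tree_msg ?A \<omega> (Suc j) (v @ [i]) = msg (?y j)" if "i < d" for i
      proof -
        have "v @ [i] \<in> tree_verts d" using Suc.prems that by (auto simp: tree_verts_def)
        then show ?thesis
          using Suc.prems Suc.IH[of "v @ [i]"] by (simp add: tree_msg_Suc del: tree_msg.simps)
      qed
      then have "spin_field ?A \<omega> (Suc j) v = ln lam + (\<Sum>i<d. msg (?y j))"
        unfolding tree_field_def by (intro arg_cong2[where f = "(+)"] refl sum.cong) auto
      then show ?case by (simp add: step_def[of "ln lam" "?y j"])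
    qed
    then show ?thesis by (simp add: tree_verts_def)
  qed
  have "AE \<omega> in \<mu>. F \<omega> = plus_prob (?y k)"
    using F(3)
  proof eventually_elim
    case (elim \<omega>)
    then show ?case using root_marginal[of ?A k \<omega>] field[of \<omega>] root by simp
  qed
  then have "(\<integral>\<omega>. F \<omega> \<partial>\<mu>) = (\<integral>\<omega>. plus_prob (?y k) \<partial>\<mu>)"
    using F(1) by (intro integral_cong_AE) auto
  moreover have "prob_space \<mu>" using gibbs by (simp add: ising_gibbs_def)
  ultimately show ?thesis using F(2) by (simp add: prob_space.prob_space)
qed

text \<open>Only boundary conditions that pin every vertex outside a ball are needed: their Gibbs measures
  are finite, so existence is elementary.\<close>

lemma weak_spatial_mixing_slope:
  assumes wsm: "weak_spatial_mixing d \<beta> lam" and fixp: "step (ln lam) ys = ys"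
  shows "d * slope ys < 1"
proof -
  define mixes where "mixes C \<kappa> \<longleftrightarrow> (\<forall>S \<sigma>\<^sub>1 \<sigma>\<^sub>2 \<mu>\<^sub>1 \<mu>\<^sub>2.
        S \<noteq> {} \<and> S \<subseteq> tree_verts d \<and>
        \<sigma>\<^sub>1 \<in> configs S \<and> \<sigma>\<^sub>2 \<in> configs S \<and>
        tree_gibbs d \<beta> lam S \<sigma>\<^sub>1 \<mu>\<^sub>1 \<and> tree_gibbs d \<beta> lam S \<sigma>\<^sub>2 \<mu>\<^sub>2 \<longrightarrow>
        \<bar>prob_plus \<mu>\<^sub>1 [] - prob_plus \<mu>\<^sub>2 []\<bar>
          \<le> C * exp (- \<kappa> * real (set_graph_dist (tree_edges d) [] S)))" for C \<kappa>
  have "\<exists>C>0. \<exists>\<kappa>>0. mixes C \<kappa>"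
    using wsm unfolding weak_spatial_mixing_def mixes_def .
  then obtain C \<kappa> where C: "0 < C" "0 < \<kappa>" and mix: "mixes C \<kappa>"
    by auto
  show ?thesis
  proof (rule slope_less_1_of_mixing[OF fixp C(2)])
    fix k
    let ?S = "tree_verts d - {v \<in> tree_verts d. length v < Suc k}"
    define \<sigma> where "\<sigma> s = (\<lambda>v\<in>?S. s)" for s :: spin
    obtain \<mu>\<^sub>1 where \<mu>1: "tree_gibbs d \<beta> lam ?S (\<sigma> Plus) \<mu>\<^sub>1"
      using tree_gibbs_exists_outside_ball[OF beta_pos lam_pos] ..
    obtain \<mu>\<^sub>2 where \<mu>2: "tree_gibbs d \<beta> lam ?S (\<sigma> Minus) \<mu>\<^sub>2"
      using tree_gibbs_exists_outside_ball[OF beta_pos lam_pos] ..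
    have "replicate (Suc k) 0 \<in> ?S" using d_pos by (auto simp: tree_verts_def)
    then have ne: "?S \<noteq> {}" by blast
    have "\<bar>prob_plus \<mu>\<^sub>1 [] - prob_plus \<mu>\<^sub>2 []\<bar>
          \<le> C * exp (- \<kappa> * real (set_graph_dist (tree_edges d) [] ?S))"
    proof (rule mix[unfolded mixes_def, rule_format], intro conjI)
      show "\<sigma> Plus \<in> configs ?S" "\<sigma> Minus \<in> configs ?S" by (simp_all only: \<sigma>_def restrict_in_configs)
    qed (use ne in \<open>simp_all add: \<mu>1 \<mu>2\<close>)
    also have "\<dots> \<le> C * exp (- \<kappa> * real (Suc k))"
    proof -
      have "Suc k \<le> set_graph_dist (tree_edges d) [] ?S"
        by (rule set_graph_dist_tree_ge[OF _ ne]) auto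
      then show ?thesis using C by simp
    qed
    moreover have "prob_plus \<mu>\<^sub>1 [] = plus_prob ((step (ln lam) ^^ k) (ln lam + d * bound))"
      using prob_plus_outside_ball[OF \<mu>1, of Plus] by (simp add: \<sigma>_def spin_msg_def)
    moreover have "prob_plus \<mu>\<^sub>2 [] = plus_prob ((step (ln lam) ^^ k) (ln lam - d * bound))"
      using prob_plus_outside_ball[OF \<mu>2, of Minus] by (simp add: \<sigma>_def spin_msg_def)
    ultimately show "\<bar>plus_prob ((step (ln lam) ^^ k) (ln lam + d * bound)) -
        plus_prob ((step (ln lam) ^^ k) (ln lam - d * bound))\<bar> \<le> C * exp (- \<kappa> * real (Suc k))"
      by simp
  qed
qed

text \<open>At depth \<open>n\<close> the recursion reads \<open>x\<close> and no longer
  \<open>p\<close>. Two systems whose pins first differ at that depth can thus be given a common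
  \<open>p\<close>, as the contraction requires.\<close>

lemma tree_msg_cong_pins:
  assumes "\<And>v. v \<in> tree_verts d \<Longrightarrow> length v < n \<Longrightarrow> v \<notin> A \<Longrightarrow> p v = p' v"
  shows "v \<in> tree_verts d \<Longrightarrow> length v + k = n \<Longrightarrow> tree_msg b A p x k v = tree_msg b A p' x k v"
proof (induction k arbitrary: v)
  case (Suc k)
  have "tree_msg b A p x k (v @ [i]) = tree_msg b A p' x k (v @ [i])" if "i < d" for i
    using Suc that by (intro Suc.IH) (auto simp: tree_verts_def)
  then show ?case using assms[of v] Suc.prems by simp
qed simp

lemma prob_plus_contraction:
  assumes fixp: "step (ln lam) ys = ys" and less: "d * slope ys < 1"
    and T: "T \<subseteq> S" "S \<subseteq> tree_verts d" "\<And>v. v \<in> T \<Longrightarrow> Suc n \<le> length v"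
    and \<sigma>: "\<forall>v\<in>S - T. \<sigma>\<^sub>1 v = \<sigma>\<^sub>2 v" and root: "[] \<notin> S"
    and gibbs: "tree_gibbs d \<beta> lam S \<sigma>\<^sub>1 \<mu>\<^sub>1" "tree_gibbs d \<beta> lam S \<sigma>\<^sub>2 \<mu>\<^sub>2"
  shows "\<bar>prob_plus \<mu>\<^sub>1 [] - prob_plus \<mu>\<^sub>2 []\<bar> \<le>
    2 * d * bound / sqrt (slope (\<bar>ln lam\<bar> + d * bound)) * sqrt (d * slope ys) ^ n"
proof -
  \<comment> \<open>All free vertices up to depth \<open>n\<close>. Everything at depth
    \<open>Suc n\<close>, whether in \<open>T\<close>, pinned alike or free with a random spin,
    counts as an arbitrary boundary value.\<close>
  define A where "A = {v \<in> tree_verts d. length v < Suc n} - S"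
  have finA: "finite A"
    by (rule finite_subset[OF _ finite_tree_ball[of d n]]) (auto simp: tree_ball_def A_def)
  have AV: "A \<subseteq> tree_verts d - S" and A_len: "A \<subseteq> {v \<in> tree_verts d. length v < Suc n}"
    and rootA: "[] \<in> A" using root by (auto simp: A_def tree_verts_def)
  \<comment> \<open>The root marginals of all configurations compatible with \<sigma>; this set does
    not mention the Gibbs measure, so bounding differences between two such sets handles all
    measures at once.\<close>
  let ?R = "\<lambda>\<sigma>. {plus_prob (spin_field A \<omega> n []) |\<omega>. \<forall>u\<in>S. \<omega> u = \<sigma> u}"
  have marginal: "\<exists>F. integrable \<mu> F \<and> prob_plus \<mu> [] = (\<integral>\<omega>. F \<omega> \<partial>\<mu>) \<and> (AE \<omega> in \<mu>. F \<omega> \<in> ?R \<sigma>)"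
    if gibbs: "tree_gibbs d \<beta> lam S \<sigma> \<mu>" for \<sigma> \<mu>
  proof -
    obtain F where F: "integrable \<mu> F" "prob_plus \<mu> [] = (\<integral>\<omega>. F \<omega> \<partial>\<mu>)"
      "AE \<omega> in \<mu>. (\<forall>u\<in>S. \<omega> u = \<sigma> u) \<and>
         F \<omega> = (\<Sum>\<tau>\<in>{\<tau> \<in> configs A. \<tau> [] = Plus}. ising_spec (tree_edges d) \<beta> lam A \<tau> \<omega>)"
      using ising_gibbs_prob_plus[OF gibbs finA AV rootA] by blast
    have "AE \<omega> in \<mu>. F \<omega> \<in> ?R \<sigma>"
      using F(3) by eventually_elim (use root_marginal[OF A_len rootA] in auto)
    then show ?thesis using F by blast
  qed
  obtain F\<^sub>1 where F1: "integrable \<mu>\<^sub>1 F\<^sub>1" "prob_plus \<mu>\<^sub>1 [] = (\<integral>\<omega>. F\<^sub>1 \<omega> \<partial>\<mu>\<^sub>1)" "AE \<omega> in \<mu>\<^sub>1. F\<^sub>1 \<omega> \<in> ?R \<sigma>\<^sub>1"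
    using marginal[OF gibbs(1)] by blast
  obtain F\<^sub>2 where F2: "integrable \<mu>\<^sub>2 F\<^sub>2" "prob_plus \<mu>\<^sub>2 [] = (\<integral>\<omega>. F\<^sub>2 \<omega> \<partial>\<mu>\<^sub>2)" "AE \<omega> in \<mu>\<^sub>2. F\<^sub>2 \<omega> \<in> ?R \<sigma>\<^sub>2"
    using marginal[OF gibbs(2)] by blast
  have contr: "\<bar>plus_prob (spin_field A \<omega>\<^sub>1 n []) - plus_prob (spin_field A \<omega>\<^sub>2 n [])\<bar> \<le>
      2 * d * bound / sqrt (slope (\<bar>ln lam\<bar> + d * bound)) * sqrt (d * slope ys) ^ n"
    if \<omega>: "\<forall>u\<in>S. \<omega>\<^sub>1 u = \<sigma>\<^sub>1 u" "\<forall>u\<in>S. \<omega>\<^sub>2 u = \<sigma>\<^sub>2 u" for \<omega>\<^sub>1 \<omega>\<^sub>2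
  proof -
    let ?x = "\<lambda>v. spin_msg (\<omega>\<^sub>1 v)" and ?x' = "\<lambda>v. spin_msg (\<omega>\<^sub>2 v)"
    have pins: "?x' v = ?x v" if "v \<in> tree_verts d" "length v < Suc n" "v \<notin> A" for v
    proof -
      have "v \<in> S - T" using that T(3)[of v] by (auto simp: A_def)
      then show ?thesis using \<omega> \<sigma> by auto
    qed
    have "tree_msg (ln lam) A ?x' ?x' n [i] = tree_msg (ln lam) A ?x ?x' n [i]" if "i < d" for i
      by (rule tree_msg_cong_pins[where n = "Suc n"]) (use pins that in \<open>auto simp: tree_verts_def\<close>)
    then have "spin_field A \<omega>\<^sub>2 n [] = tree_field (ln lam) A ?x ?x' n []"
      by (simp add: tree_field_def)
    moreover have "\<bar>tree_field (ln lam) A ?x ?x n [] - tree_field (ln lam) A ?x ?x' n []\<bar> \<le>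
      2 * d * bound / sqrt (slope (\<bar>ln lam\<bar> + d * bound)) * sqrt (d * slope ys) ^ n"
      by (rule tree_field_contraction[OF fixp less]) simp_all
    ultimately show ?thesis by (metis order.trans plus_prob_lipschitz)
  qed
  have "prob_space \<mu>\<^sub>1" "prob_space \<mu>\<^sub>2" using gibbs by (auto simp: ising_gibbs_def)
  then show ?thesis unfolding F1(2) F2(2)
    by (rule integral_diff_le[OF _ _ F1(1) F2(1) F1(3) F2(3)]) (use contr in force)
qed

lemma strong_spatial_mixing_of_slope:
  assumes fixp: "step (ln lam) ys = ys" and less: "d * slope ys < 1"
  shows "strong_spatial_mixing d \<beta> lam"
proof -
  define \<alpha> where "\<alpha> = sqrt (d * slope ys)"
  define M where "M = 2 * d * bound / sqrt (slope (\<bar>ln lam\<bar> + d * bound))"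
  have \<alpha>: "0 < \<alpha>" "\<alpha> < 1" using less slope_pos[of ys] d_pos by (simp_all add: \<alpha>_def)
  have M: "0 < M" using bound_pos d_pos slope_pos by (simp add: M_def)
  \<comment> \<open>The value 1 covers distance 0, where only the trivial bound is available; the
    division by \<alpha> makes up for the contraction running over one level less than the
    distance.\<close>
  define C where "C = max 1 (M / \<alpha>)"
  have C: "1 \<le> C" "M / \<alpha> \<le> C" "0 < C" by (simp_all add: C_def)
  define \<kappa> where "\<kappa> = - ln \<alpha>"
  have \<kappa>: "0 < \<kappa>" using \<alpha> by (simp add: \<kappa>_def)
  have exp: "exp (- \<kappa> * real n) = \<alpha> ^ n" for n
    using \<alpha> by (simp add: \<kappa>_def exp_of_nat2_mult)
  show ?thesis unfolding strong_spatial_mixing_def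
  proof (rule exI[of _ C], rule conjI[OF C(3)], rule exI[of _ \<kappa>], rule conjI[OF \<kappa>], intro allI impI)
    fix S T \<sigma>\<^sub>1 \<sigma>\<^sub>2 \<mu>\<^sub>1 \<mu>\<^sub>2
    assume "S \<noteq> {} \<and> S \<subseteq> tree_verts d \<and> T \<noteq> {} \<and> T \<subseteq> S \<and>
        \<sigma>\<^sub>1 \<in> configs S \<and> \<sigma>\<^sub>2 \<in> configs S \<and> (\<forall>v\<in>S - T. \<sigma>\<^sub>1 v = \<sigma>\<^sub>2 v) \<and>
        tree_gibbs d \<beta> lam S \<sigma>\<^sub>1 \<mu>\<^sub>1 \<and> tree_gibbs d \<beta> lam S \<sigma>\<^sub>2 \<mu>\<^sub>2"
    then have S: "S \<subseteq> tree_verts d" "T \<subseteq> S" and \<sigma>: "\<forall>v\<in>S - T. \<sigma>\<^sub>1 v = \<sigma>\<^sub>2 v"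
      and gibbs: "tree_gibbs d \<beta> lam S \<sigma>\<^sub>1 \<mu>\<^sub>1" "tree_gibbs d \<beta> lam S \<sigma>\<^sub>2 \<mu>\<^sub>2" by auto
    have prob: "prob_space \<mu>\<^sub>1" "prob_space \<mu>\<^sub>2" using gibbs by (auto simp: ising_gibbs_def)
    let ?n = "set_graph_dist (tree_edges d) [] T"
    have T_len: "?n \<le> length v" if "v \<in> T" for v
      using set_graph_dist_tree_le[of T d v] S that by blast
    have "\<bar>prob_plus \<mu>\<^sub>1 [] - prob_plus \<mu>\<^sub>2 []\<bar> \<le> C * \<alpha> ^ ?n"
    proof (cases ?n)
      case 0
      then show ?thesis
        using C(1) prob_plus_bounds[OF prob(1), of "[]"] prob_plus_bounds[OF prob(2), of "[]"]
        by (simp add: abs_le_iff)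
    next
      case (Suc n)
      have nonneg: "0 \<le> C * \<alpha> ^ ?n" using C(1) \<alpha> by simp
      show ?thesis
      proof (cases "[] \<in> S")
        case True
        \<comment> \<open>At positive distance \<open>T\<close> misses the root, so a pinned root
          has the same spin in both systems and the two probabilities coincide.\<close>
        then have "[] \<in> S - T" using T_len[of "[]"] Suc by auto
        have pinned: "prob_plus \<mu> [] = (if \<sigma> [] = Plus then 1 else 0)"
          if g: "tree_gibbs d \<beta> lam S \<sigma> \<mu>" for \<sigma> \<mu>
        proof -
          interpret prob_space \<mu> using g by (simp add: ising_gibbs_def)
          have sets: "sets \<mu> = sets (config_space (tree_verts d))" using g by (simp add: ising_gibbs_def)
          have meas: "{\<omega> \<in> space \<mu>. \<omega> [] = Plus} \<in> sets \<mu>"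
            using sets_cylinder[OF sets, of "{[]}" "\<lambda>_. Plus"] by (simp add: tree_verts_def)
          have "AE \<omega> in \<mu>. \<omega> [] = \<sigma> []"
            using g True by (auto simp: ising_gibbs_def)
          then have "measure \<mu> {\<omega> \<in> space \<mu>. \<omega> [] = Plus} = measure \<mu> (if \<sigma> [] = Plus then space \<mu> else {})"
            using meas by (intro finite_measure_eq_AE) auto
          then show ?thesis by (simp add: prob_plus_def prob_space split: if_splits)
        qed
        have "prob_plus \<mu>\<^sub>1 [] = prob_plus \<mu>\<^sub>2 []"
          using pinned[OF gibbs(1)] pinned[OF gibbs(2)] \<sigma> \<open>[] \<in> S - T\<close> by simp
        then show ?thesis using nonneg by simp
      next
        case False
        have "\<bar>prob_plus \<mu>\<^sub>1 [] - prob_plus \<mu>\<^sub>2 []\<bar> \<le> M * \<alpha> ^ n"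
          unfolding M_def \<alpha>_def
          by (rule prob_plus_contraction[OF fixp less S(2,1) _ \<sigma> False gibbs]) (use T_len Suc in auto)
        also have "\<dots> = M / \<alpha> * \<alpha> ^ ?n" using \<alpha> Suc by simp
        also have "\<dots> \<le> C * \<alpha> ^ ?n" using C(2) \<alpha> by (intro mult_right_mono) auto
        finally show ?thesis .
      qed
    qed
    then show "\<bar>prob_plus \<mu>\<^sub>1 [] - prob_plus \<mu>\<^sub>2 []\<bar> \<le> C * exp (- \<kappa> * real ?n)"
      unfolding exp .
  qed
qed

end

theorem theorem1p1:
  fixes d :: nat and \<beta> lam :: real
  assumes "d \<ge> 2" and "0 < \<beta>" and "\<beta> < 1" and "lam > 0"
    and "weak_spatial_mixing d \<beta> lam"
  shows "strong_spatial_mixing d \<beta> lam"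
proof -
  interpret antiferro_tree \<beta> d lam
    using assms by unfold_locales auto
  obtain ys where "step (ln lam) ys = ys" using step_fixed_point by blast
  then show ?thesis
    using weak_spatial_mixing_slope[OF assms(5)] strong_spatial_mixing_of_slope by blast
qed

end
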